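(* For every $d\in\mathbb{N}$ let $C_\gamma\ge\gamma_{d,1}\ge\gamma_{d,2}\ge\cdots\ge\gamma_{d,d}>0$, where $C_\gamma$ does not depend on $d$, and put $\gamma_{\boldsymbol\alpha}=\prod_{j=1}^d(\gamma_{d,j})^{\alpha_j}$ for $\boldsymbol\alpha\in\mathbb{N}_0^d$. Let $$F_d^\gamma=\{f\in C^\infty([0,1]^d)\mid \|f\mid F_d^\gamma\|<\infty\},\qquad \|f\mid F_d^\gamma\|=\sup_{\boldsymbol\alpha\in\mathbb{N}_0^d}\frac1{\gamma_{\boldsymbol\alpha}}\|D^{\boldsymbol\alpha}f\mid L_\infty([0,1]^d)\|,$$ (real-valued functions) and consider the uniform approximation problem $\mathrm{App}=(\mathrm{App}_d\colon F_d^\gamma\to L_\infty([0,1]^d))_{d\in\mathbb{N}}$, $\mathrm{App}_d(f)=f$, in the worst case setting with respect to the absolute error criterion. Define $$p(\gamma)=\inf\Big\{\kappa>0\;\Big|\;\limsup_{d\to\infty}\sum_{j=1}^d(\gamma_{d,j})^\kappa<\infty\Big\},\qquad q(\gamma)=\inf\Big\{\kappa>0\;\Big|\;\limsup_{d\to\infty}\frac{\sum_{j=1}^d(\gamma_{d,j})^\kappa}{\ln(d+1)}<\infty\Big\}$$ with $\inf\emptyset=\infty$. Then, both for the class of linear algorithms and for the class of algorithms using non-adaptive continuous or adaptive linear information: (1) If $\mathrm{App}$ is polynomially tractable then $q(\gamma)\le1$. If $\mathrm{App}$ is strongly polynomially tractable then $p(\gamma)\le1$. (2) If $q(\gamma)<1$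 then $\mathrm{App}$ is polynomially tractable. If $p(\gamma)<1$ then $\mathrm{App}$ is strongly polynomially tractable.
   Context: Algorithms using at most $n$ pieces of information on $f\in F_d^\gamma$: (a) linear algorithms $Af=\sum_{j=1}^nL_j(f)g_j$ with continuous linear functionals $L_j$ on $F_d^\gamma$ and $g_j\in L_\infty([0,1]^d)$; (b) algorithms $A=\varphi\circ N$ with arbitrary $\varphi\colon\mathbb{R}^n\to L_\infty([0,1]^d)$ and either $N(f)=(L_1(f),\dots,L_n(f))$ with continuous, not necessarily linear, $L_j$, or adaptive $N(f)=(y_1,\dots,y_n)$ with $y_1=L_1(f)$, $y_j=L_j(f;y_1,\dots,y_{j-1})$, where each $L_j(\cdot\,;y_1,\dots,y_{j-1})$ is a continuous linear functional. For $n=0$ an algorithm is a constant map ($0$ in the linear case). For a fixed class, $e(n,d)=\inf_A\sup_{\|f\mid F_d^\gamma\|\le1}\|f-Af\mid L_\infty([0,1]^d)\|$ over all algorithms of that class using at most $n$ pieces of information, and $n(\varepsilon,d)=\min\{n\in\mathbb{N}_0\mid e(n,d)\le\varepsilon\}$. The problem is polynomially tractable if there are $C,p>0$, $q\ge0$ with $n(\varepsilon,d)\le C\varepsilon^{-p}d^q$ for all $\varepsilon\in(0,1]$, $d\in\mathbb{N}$, and strongly polynomially tractable if this holds with $q=0$. *)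

theory Defs
  imports "HOL-Probability.Probability"
begin

text \<open>
  The dimension varies, so a point of \<open>[0,1]\<^sup>d\<close> is a function \<open>x\<close> on the index set
  \<open>{1..d}\<close> (extensional, i.e. \<open>undefined\<close> at all other indices).  The product topology on
  \<^typ>\<open>nat \<Rightarrow> real\<close> induces the Euclidean topology on this cube.
\<close>

type_synonym point = "nat \<Rightarrow> real"
type_synonym rfun = "point \<Rightarrow> real"

definition cube :: "nat \<Rightarrow> point set" where
  "cube d = ({1..d} \<rightarrow>\<^sub>E {0..1})"

text \<open>Lebesgue measure on the cube, with all Lebesgue measurable sets.\<close>

definition cube_measure :: "nat \<Rightarrow> point measure" where
  "cube_measure d = completion (PiM {1..d} (\<lambda>_. restrict_space lborel {0..1}))"

definition Linf_norm :: "nat \<Rightarrow> rfun \<Rightarrow> ereal" where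
  "Linf_norm d g = esssup (cube_measure d) (\<lambda>x. ereal \<bar>g x\<bar>)"

text \<open>Elements are representatives; functions that agree almost everywhere are not identified.\<close>

definition Linf :: "nat \<Rightarrow> rfun set" where
  "Linf d = {g. g \<in> borel_measurable (cube_measure d) \<and> Linf_norm d g < \<infinity>}"

text \<open>
  Derivatives are taken relative to the closed cube, so they are one-sided on its boundary.
  For the functions below, all of whose iterated partial derivatives exist and are continuous on
  the closed cube, these are the continuous extensions of the derivatives in the interior.
\<close>

definition partial_deriv :: "nat \<Rightarrow> rfun \<Rightarrow> rfun" where
  "partial_deriv j f = (\<lambda>x. vector_derivative (\<lambda>t. f (x(j := t))) (at (x j) within {0..1}))"

definition has_partial_deriv_on_cube :: "nat \<Rightarrow> nat \<Rightarrow> rfun \<Rightarrow> bool" where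
  "has_partial_deriv_on_cube d j f \<longleftrightarrow>
     (\<forall>x\<in>cube d. (\<lambda>t. f (x(j := t))) differentiable (at (x j) within {0..1}))"

definition smooth_on_cube :: "nat \<Rightarrow> rfun \<Rightarrow> bool" where
  "smooth_on_cube d f \<longleftrightarrow>
     (\<forall>js. set js \<subseteq> {1..d} \<longrightarrow>
        continuous_on (cube d) (foldr partial_deriv js f) \<and>
        (\<forall>j\<in>{1..d}. has_partial_deriv_on_cube d j (foldr partial_deriv js f)))"

definition multi_indices :: "nat \<Rightarrow> (nat \<Rightarrow> nat) set" where
  "multi_indices d = ({1..d} \<rightarrow>\<^sub>E UNIV)"

definition mixed_deriv :: "nat \<Rightarrow> (nat \<Rightarrow> nat) \<Rightarrow> rfun \<Rightarrow> rfun" where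
  "mixed_deriv d \<alpha> f = foldr (\<lambda>j. partial_deriv j ^^ \<alpha> j) [1..<Suc d] f"

definition weight :: "(nat \<Rightarrow> nat \<Rightarrow> real) \<Rightarrow> nat \<Rightarrow> (nat \<Rightarrow> nat) \<Rightarrow> real" where
  "weight \<gamma> d \<alpha> = (\<Prod>j=1..d. \<gamma> d j ^ \<alpha> j)"

definition F_norm :: "(nat \<Rightarrow> nat \<Rightarrow> real) \<Rightarrow> nat \<Rightarrow> rfun \<Rightarrow> ereal" where
  "F_norm \<gamma> d f =
     (SUP \<alpha>\<in>multi_indices d. ereal (1 / weight \<gamma> d \<alpha>) * Linf_norm d (mixed_deriv d \<alpha> f))"

text \<open>
  A function on the cube is represented by its extension by \<open>0\<close>, which is a bijection
  compatible with the pointwise linear operations.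
\<close>

definition F_space :: "(nat \<Rightarrow> nat \<Rightarrow> real) \<Rightarrow> nat \<Rightarrow> rfun set" where
  "F_space \<gamma> d =
     {f. smooth_on_cube d f \<and> (\<forall>x. x \<notin> cube d \<longrightarrow> f x = 0) \<and> F_norm \<gamma> d f < \<infinity>}"

definition continuous_functional ::
    "(nat \<Rightarrow> nat \<Rightarrow> real) \<Rightarrow> nat \<Rightarrow> (rfun \<Rightarrow> real) \<Rightarrow> bool" where
  "continuous_functional \<gamma> d L \<longleftrightarrow>
     (\<forall>f\<in>F_space \<gamma> d. \<forall>\<epsilon>>0. \<exists>\<delta>>0. \<forall>g\<in>F_space \<gamma> d.
        F_norm \<gamma> d (\<lambda>x. g x - f x) < ereal \<delta> \<longrightarrow> \<bar>L g - L f\<bar> < \<epsilon>)"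

definition linear_functional ::
    "(nat \<Rightarrow> nat \<Rightarrow> real) \<Rightarrow> nat \<Rightarrow> (rfun \<Rightarrow> real) \<Rightarrow> bool" where
  "linear_functional \<gamma> d L \<longleftrightarrow>
     (\<forall>f\<in>F_space \<gamma> d. \<forall>g\<in>F_space \<gamma> d. L (\<lambda>x. f x + g x) = L f + L g) \<and>
     (\<forall>c. \<forall>f\<in>F_space \<gamma> d. L (\<lambda>x. c * f x) = c * L f)"

definition continuous_linear_functional ::
    "(nat \<Rightarrow> nat \<Rightarrow> real) \<Rightarrow> nat \<Rightarrow> (rfun \<Rightarrow> real) \<Rightarrow> bool" where
  "continuous_linear_functional \<gamma> d L \<longleftrightarrow>
     linear_functional \<gamma> d L \<and> continuous_functional \<gamma> d L"

text \<open>
  Only the values of an algorithm on \<open>F_space \<gamma> d\<close> matter.  An algorithm class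
  maps \<open>d\<close> and \<open>n\<close> to the algorithms in dimension \<open>d\<close> that use at most \<open>n\<close>
  pieces of information.
\<close>

type_synonym algorithm = "rfun \<Rightarrow> rfun"
type_synonym algorithm_class = "nat \<Rightarrow> nat \<Rightarrow> algorithm set"

definition linear_algorithms :: "(nat \<Rightarrow> nat \<Rightarrow> real) \<Rightarrow> algorithm_class" where
  "linear_algorithms \<gamma> d n =
     {A. \<exists>m\<le>n. \<exists>L g.
        (\<forall>j\<in>{1..m}. continuous_linear_functional \<gamma> d (L j) \<and> g j \<in> Linf d) \<and>
        (\<forall>f\<in>F_space \<gamma> d. A f = (\<lambda>x. \<Sum>j=1..m. L j f * g j x))}"

definition nonadaptive_info :: "(nat \<Rightarrow> rfun \<Rightarrow> real) \<Rightarrow> nat \<Rightarrow> rfun \<Rightarrow> real list" where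
  "nonadaptive_info L m f = map (\<lambda>j. L j f) [1..<Suc m]"

text \<open>
  In adaptive information the \<open>j\<close>-th functional is \<open>L [y\<^sub>1, \<dots>, y\<^sub>j\<^sub>-\<^sub>1]\<close>; the index \<open>j\<close>
  is determined by the length of the list.
\<close>

fun adaptive_info :: "(real list \<Rightarrow> rfun \<Rightarrow> real) \<Rightarrow> nat \<Rightarrow> rfun \<Rightarrow> real list" where
  "adaptive_info L 0 f = []"
| "adaptive_info L (Suc m) f = (let y = adaptive_info L m f in y @ [L y f])"

definition nonadaptive_continuous_information ::
    "(nat \<Rightarrow> nat \<Rightarrow> real) \<Rightarrow> nat \<Rightarrow> nat \<Rightarrow> (rfun \<Rightarrow> real list) set" where
  "nonadaptive_continuous_information \<gamma> d m =
     {nonadaptive_info L m | L. \<forall>j\<in>{1..m}. continuous_functional \<gamma> d (L j)}"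

definition adaptive_linear_information ::
    "(nat \<Rightarrow> nat \<Rightarrow> real) \<Rightarrow> nat \<Rightarrow> nat \<Rightarrow> (rfun \<Rightarrow> real list) set" where
  "adaptive_linear_information \<gamma> d m =
     {adaptive_info L m | L. \<forall>y. length y < m \<longrightarrow> continuous_linear_functional \<gamma> d (L y)}"

text \<open>A vector in \<open>\<real>\<^sup>m\<close> is a list of length \<open>m\<close>.\<close>

definition general_algorithms :: "(nat \<Rightarrow> nat \<Rightarrow> real) \<Rightarrow> algorithm_class" where
  "general_algorithms \<gamma> d n =
     {A. \<exists>m\<le>n. \<exists>N \<phi>.
        N \<in> nonadaptive_continuous_information \<gamma> d m \<union> adaptive_linear_information \<gamma> d m \<and>
        (\<forall>y. length y = m \<longrightarrow> \<phi> y \<in> Linf d) \<and>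
        (\<forall>f\<in>F_space \<gamma> d. A f = \<phi> (N f))}"

definition worst_case_error ::
    "(nat \<Rightarrow> nat \<Rightarrow> real) \<Rightarrow> nat \<Rightarrow> algorithm \<Rightarrow> ereal" where
  "worst_case_error \<gamma> d A =
     (SUP f\<in>{f \<in> F_space \<gamma> d. F_norm \<gamma> d f \<le> 1}. Linf_norm d (\<lambda>x. f x - A f x))"

definition minimal_error ::
    "(nat \<Rightarrow> nat \<Rightarrow> real) \<Rightarrow> algorithm_class \<Rightarrow> nat \<Rightarrow> nat \<Rightarrow> ereal" where
  "minimal_error \<gamma> \<A> n d = (INF A\<in>\<A> d n. worst_case_error \<gamma> d A)"

text \<open>The minimum is \<open>\<infinity>\<close> if no \<open>n\<close> qualifies.\<close>

definition info_complexity ::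
    "(nat \<Rightarrow> nat \<Rightarrow> real) \<Rightarrow> algorithm_class \<Rightarrow> real \<Rightarrow> nat \<Rightarrow> enat" where
  "info_complexity \<gamma> \<A> \<epsilon> d = Inf {enat n | n. minimal_error \<gamma> \<A> n d \<le> ereal \<epsilon>}"

definition tractable_with_exponents ::
    "(nat \<Rightarrow> nat \<Rightarrow> real) \<Rightarrow> algorithm_class \<Rightarrow> real \<Rightarrow> real \<Rightarrow> real \<Rightarrow> bool" where
  "tractable_with_exponents \<gamma> \<A> C p q \<longleftrightarrow>
     (\<forall>\<epsilon> d. 0 < \<epsilon> \<longrightarrow> \<epsilon> \<le> 1 \<longrightarrow> 1 \<le> d \<longrightarrow>
        ereal_of_enat (info_complexity \<gamma> \<A> \<epsilon> d) \<le> ereal (C * \<epsilon> powr (- p) * real d powr q))"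

definition polynomially_tractable ::
    "(nat \<Rightarrow> nat \<Rightarrow> real) \<Rightarrow> algorithm_class \<Rightarrow> bool" where
  "polynomially_tractable \<gamma> \<A> \<longleftrightarrow>
     (\<exists>C p q. 0 < C \<and> 0 < p \<and> 0 \<le> q \<and> tractable_with_exponents \<gamma> \<A> C p q)"

definition strongly_polynomially_tractable ::
    "(nat \<Rightarrow> nat \<Rightarrow> real) \<Rightarrow> algorithm_class \<Rightarrow> bool" where
  "strongly_polynomially_tractable \<gamma> \<A> \<longleftrightarrow>
     (\<exists>C p. 0 < C \<and> 0 < p \<and> tractable_with_exponents \<gamma> \<A> C p 0)"

definition p_exponent :: "(nat \<Rightarrow> nat \<Rightarrow> real) \<Rightarrow> ereal" where
  "p_exponent \<gamma> =
     Inf {ereal \<kappa> | \<kappa>. 0 < \<kappa> \<and> limsup (\<lambda>d. ereal (\<Sum>j=1..d. \<gamma> d j powr \<kappa>)) < \<infinity>}"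

definition q_exponent :: "(nat \<Rightarrow> nat \<Rightarrow> real) \<Rightarrow> ereal" where
  "q_exponent \<gamma> =
     Inf {ereal \<kappa> | \<kappa>. 0 < \<kappa> \<and>
       limsup (\<lambda>d. ereal ((\<Sum>j=1..d. \<gamma> d j powr \<kappa>) / ln (real d + 1))) < \<infinity>}"

end

theory Submission
  imports Defs
begin

text \<open>
  Upper bounds. A function in the unit ball equals its Taylor series at the corner \<open>0\<close>, whose terms are bounded by
  \<open>a\<^sub>\<alpha> = \<Prod>\<^sub>j \<gamma>\<^sub>j\<^bsup>\<alpha>\<^sub>j\<^esup> / \<alpha>\<^sub>j!\<close>. The linear algorithm keeps the terms with \<open>a\<^sub>\<alpha> > \<delta>\<close>. If
  \<open>\<kappa> < 1\<close> and \<open>E = \<Sum>\<^sub>\<alpha> a\<^sub>\<alpha>\<^bsup>\<kappa>\<^esup> \<le> exp (K \<Sum>\<^sub>j \<gamma>\<^sub>j\<^bsup>\<kappa>\<^esup>)\<close>, it uses at most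
  \<open>\<delta>\<^bsup>-\<kappa>\<^esup> E\<close> functionals and has error at most \<open>\<delta>\<^bsup>1-\<kappa>\<^esup> E\<close>.

  Lower bounds. Group the coordinates into \<open>s\<close> blocks of total weight between \<open>2\<close> and \<open>2 + C\<close>. The multilinear
  functions of the \<open>s\<close> weighted block means form a copy of \<open>\<ell>\<^sub>\<infinity>\<close> of dimension \<open>2\<^sup>s\<close> on which the norm of
  \<open>F\<^sub>d\<close> is the maximum norm. Fewer than \<open>2\<^sup>s\<close> continuous functionals cannot separate the points of its unit cube
  at distance \<open>1/2\<close>, so the error stays above a constant and \<open>2\<^sup>s\<close> is at most polynomial in \<open>d\<close>, that is,
  \<open>\<Sum>\<^sub>j \<gamma>\<^sub>j = O(ln d)\<close>. Adaptive linear information is reduced to the non-adaptive case by following the branch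
  in which all answers are \<open>0\<close>. The non-separation result replaces the Borsuk--Ulam theorem; it follows from Kuhn's
  combinatorial lemma and a counting argument.
\<close>

section \<open>Large fibres of dimension-lowering maps\<close>

text \<open>Bolzano-Weierstrass, at the cost of one further subsequence per coordinate. Only the
  first \<open>m\<close> values of the functions count as coordinates.\<close>

lemma unit_cube_convergent_subsequence:
  fixes X :: "nat \<Rightarrow> nat \<Rightarrow> real"
  assumes "\<And>k i. i < m \<Longrightarrow> X k i \<in> {0..1}"
  shows "\<exists>r l. strict_mono (r :: nat \<Rightarrow> nat) \<and> (\<forall>i<m. l i \<in> {0..1} \<and> (\<lambda>k. X (r k) i) \<longlonglongrightarrow> l i)"
  using assms
proof (induction m)
  case 0
  then show ?case by (auto intro!: exI[of _ id] strict_mono_id)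
next
  case (Suc m)
  then obtain r l where r: "strict_mono (r :: nat \<Rightarrow> nat)"
    and l: "\<And>i. i < m \<Longrightarrow> l i \<in> {0..1::real} \<and> (\<lambda>k. X (r k) i) \<longlonglongrightarrow> l i"
    by (metis less_SucI)
  have "seq_compact {0..1::real}"
    using compact_Icc compact_eq_seq_compact_metric by blast
  moreover have "\<forall>k. X (r k) m \<in> {0..1}" using Suc.prems by blast
  ultimately obtain a s where a: "a \<in> {0..1}" and s: "strict_mono (s :: nat \<Rightarrow> nat)"
    and as: "((\<lambda>k. X (r k) m) \<circ> s) \<longlonglongrightarrow> a"
    by (metis seq_compactE)
  have "strict_mono (r \<circ> s)" using r s by (rule strict_mono_o)
  moreover have "(l(m := a)) i \<in> {0..1} \<and> (\<lambda>k. X ((r \<circ> s) k) i) \<longlonglongrightarrow> (l(m := a)) i" if "i < Suc m" for i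
  proof (cases "i = m")
    case True
    then show ?thesis using a as by (simp add: o_def)
  next
    case False
    with that have "i < m" by simp
    then show ?thesis using l[of i] LIMSEQ_subseq_LIMSEQ[OF _ s, of "\<lambda>k. X (r k) i"] False
      by (simp add: o_def)
  qed
  ultimately show ?case by blast
qed

text \<open>In the application a point lists the \<open>2 ^ s\<close> vertex values of a multilinear
  function, and \<open>N\<close> is the information gained from \<open>n\<close>
  functionals.\<close>

locale cube_map =
  fixes m n :: nat and N :: "(nat \<Rightarrow> real) \<Rightarrow> nat \<Rightarrow> real"
  assumes dims: "n < m"
    and cont: "\<And>x k \<epsilon>. (\<forall>i<m. x i \<in> {0..1}) \<Longrightarrow> k < n \<Longrightarrow> 0 < \<epsilon> \<Longrightarrow>
      \<exists>\<delta>>0. \<forall>y. (\<forall>i<m. y i \<in> {0..1}) \<longrightarrow> (\<forall>i<m. \<bar>y i - x i\<bar> < \<delta>) \<longrightarrow> \<bar>N y k - N x k\<bar> < \<epsilon>"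
begin

definition Q :: "(nat \<Rightarrow> real) set" where
  "Q = {x. \<forall>i<m. x i \<in> {0..1}}"

text \<open>The l1 distance of the images: a pseudometric that is 0 exactly between points of the
  same fibre.\<close>

definition D :: "(nat \<Rightarrow> real) \<Rightarrow> (nat \<Rightarrow> real) \<Rightarrow> real" where
  "D x y = (\<Sum>k<n. \<bar>N x k - N y k\<bar>)"

lemma N_tendsto:
  assumes X: "\<And>j. X j \<in> Q" and l: "l \<in> Q" and lim: "\<And>i. i < m \<Longrightarrow> (\<lambda>j. X j i) \<longlonglongrightarrow> l i" and k: "k < n"
  shows "(\<lambda>j. N (X j) k) \<longlonglongrightarrow> N l k"
proof (rule tendstoI)
  fix e :: real assume "e > 0"
  then obtain d where d: "d > 0" and
    dd: "\<And>y. y \<in> Q \<Longrightarrow> (\<forall>i<m. \<bar>y i - l i\<bar> < d) \<Longrightarrow> \<bar>N y k - N l k\<bar> < e"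
    using cont[of l k e] l k by (auto simp: Q_def)
  have "\<forall>\<^sub>F j in sequentially. \<forall>i\<in>{..<m}. \<bar>X j i - l i\<bar> < d"
    using tendstoD[OF lim d] by (intro eventually_ball_finite) (auto simp: dist_real_def)
  then show "\<forall>\<^sub>F j in sequentially. dist (N (X j) k) (N l k) < e"
    by eventually_elim (use dd X in \<open>auto simp: dist_real_def\<close>)
qed

lemma convergent_subsequence:
  assumes "\<And>j. X j \<in> Q"
  obtains r l where "strict_mono (r :: nat \<Rightarrow> nat)" "l \<in> Q" "\<And>i. i < m \<Longrightarrow> (\<lambda>j. X (r j) i) \<longlonglongrightarrow> l i"
    "\<And>k. k < n \<Longrightarrow> (\<lambda>j. N (X (r j)) k) \<longlonglongrightarrow> N l k"
proof -
  obtain r l where r: "strict_mono (r :: nat \<Rightarrow> nat)"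
    and l: "\<forall>i<m. l i \<in> {0..1::real} \<and> (\<lambda>j. X (r j) i) \<longlonglongrightarrow> l i"
    using unit_cube_convergent_subsequence[of m X] assms by (auto simp: Q_def)
  show ?thesis
  proof (rule that[OF r])
    show "l \<in> Q" using l by (auto simp: Q_def)
    then show "(\<lambda>j. N (X (r j)) k) \<longlonglongrightarrow> N l k" if "k < n" for k
      using N_tendsto[of "\<lambda>j. X (r j)" l k] assms l that by auto
  qed (use l in auto)
qed

lemma D_triangle: "D x z \<le> D x y + D y z"
  unfolding D_def sum.distrib[symmetric] by (intro sum_mono) auto

lemma D_commute: "D x y = D y x"
  unfolding D_def by (intro sum.cong) auto

lemma D_nonneg: "0 \<le> D x y"
  unfolding D_def by (intro sum_nonneg) auto

lemma D_ge: "k < n \<Longrightarrow> \<bar>N x k - N y k\<bar> \<le> D x y"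
  unfolding D_def by (rule member_le_sum) auto

lemma N_bounded: "\<exists>R\<ge>0. \<forall>x\<in>Q. \<forall>k<n. \<bar>N x k\<bar> \<le> R"
proof (rule ccontr)
  assume neg: "\<not> ?thesis"
  have "\<forall>j::nat. \<exists>x\<in>Q. \<exists>k<n. \<bar>N x k\<bar> > real j"
    using neg by (meson not_le of_nat_0_le_iff)
  then obtain X K where X: "\<And>j. X j \<in> Q" and XK: "\<And>j. K j < n \<and> \<bar>N (X j) (K j)\<bar> > real j"
    by metis
  obtain r l where r: "strict_mono (r :: nat \<Rightarrow> nat)"
    and N: "\<And>k. k < n \<Longrightarrow> (\<lambda>j. N (X (r j)) k) \<longlonglongrightarrow> N l k"
    using convergent_subsequence[of X] X by metis
  \<comment> \<open>The offending index \<open>K j\<close> may change with \<open>j\<close>, so the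
    bound is drawn from the sum over all indices.\<close>
  have "(\<lambda>j. \<Sum>k<n. \<bar>N (X (r j)) k\<bar>) \<longlonglongrightarrow> (\<Sum>k<n. \<bar>N l k\<bar>)"
    by (intro tendsto_sum tendsto_rabs N) auto
  then have "Bseq (\<lambda>j. \<Sum>k<n. \<bar>N (X (r j)) k\<bar>)"
    by (intro convergent_imp_Bseq convergentI)
  then obtain B where B: "\<And>j. norm (\<Sum>k<n. \<bar>N (X (r j)) k\<bar>) \<le> B" by (auto simp: Bseq_def)
  obtain j :: nat where j: "real j > B" using reals_Archimedean2 by blast
  have "real j \<le> real (r j)" using seq_suble[OF r, of j] by simp
  also have "\<dots> < \<bar>N (X (r j)) (K (r j))\<bar>" using XK by auto
  also have "\<dots> \<le> (\<Sum>k<n. \<bar>N (X (r j)) k\<bar>)" using XK by (intro member_le_sum) auto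
  also have "\<dots> \<le> B" using B[of j] by auto
  finally show False using j by simp
qed

text \<open>Heine-Cantor: violating pairs at distances tending to 0 would have a common limit point,
  along which \<open>D\<close> tends to 0.\<close>

lemma D_uniformly_continuous:
  assumes "\<tau> > 0"
  shows "\<exists>\<rho>>0. \<forall>x\<in>Q. \<forall>y\<in>Q. (\<forall>i<m. \<bar>x i - y i\<bar> \<le> \<rho>) \<longrightarrow> D x y < \<tau>"
proof (rule ccontr)
  assume neg: "\<not> ?thesis"
  have "\<forall>j::nat. \<exists>x\<in>Q. \<exists>y\<in>Q. (\<forall>i<m. \<bar>x i - y i\<bar> \<le> 1 / real (Suc j)) \<and> D x y \<ge> \<tau>"
    using neg by (metis not_le of_nat_0_less_iff zero_less_Suc zero_less_divide_1_iff)
  then obtain X Y where X: "\<And>j. X j \<in> Q" and Y: "\<And>j. Y j \<in> Q"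
    and XY: "\<And>j i. i < m \<Longrightarrow> \<bar>X j i - Y j i\<bar> \<le> 1 / real (Suc j)" and D: "\<And>j. D (X j) (Y j) \<ge> \<tau>"
    by metis
  obtain r l where r: "strict_mono (r :: nat \<Rightarrow> nat)" and l: "l \<in> Q"
    and lim: "\<And>i. i < m \<Longrightarrow> (\<lambda>j. X (r j) i) \<longlonglongrightarrow> l i"
    and N: "\<And>k. k < n \<Longrightarrow> (\<lambda>j. N (X (r j)) k) \<longlonglongrightarrow> N l k"
    using convergent_subsequence[of X] X by metis
  have Ylim: "(\<lambda>j. Y (r j) i) \<longlonglongrightarrow> l i" if i: "i < m" for i
  proof -
    have "(\<lambda>j. X (r j) i - Y (r j) i) \<longlonglongrightarrow> 0"
    proof (rule Lim_null_comparison)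
      show "\<forall>\<^sub>F j in sequentially. norm (X (r j) i - Y (r j) i) \<le> 1 / real (Suc (r j))"
        using XY i by auto
      show "(\<lambda>j. 1 / real (Suc (r j))) \<longlonglongrightarrow> 0"
        using LIMSEQ_subseq_LIMSEQ[OF LIMSEQ_inverse_real_of_nat r] by (simp add: o_def inverse_eq_divide)
    qed
    from tendsto_diff[OF lim[OF i] this] show ?thesis by simp
  qed
  have N': "(\<lambda>j. N (Y (r j)) k) \<longlonglongrightarrow> N l k" if "k < n" for k
    using N_tendsto[of "\<lambda>j. Y (r j)" l k] Y l Ylim that by auto
  have "(\<lambda>j. D (X (r j)) (Y (r j))) \<longlonglongrightarrow> (\<Sum>k<n. \<bar>N l k - N l k\<bar>)"
    unfolding D_def by (intro tendsto_sum tendsto_rabs tendsto_diff N N') auto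
  then have "(\<lambda>j. D (X (r j)) (Y (r j))) \<longlonglongrightarrow> 0" by simp
  then have "\<forall>\<^sub>F j in sequentially. D (X (r j)) (Y (r j)) < \<tau>"
    using assms by (rule order_tendstoD)
  then obtain j where "D (X (r j)) (Y (r j)) < \<tau>" by (auto simp: eventually_sequentially)
  with D[of "r j"] show False by simp
qed

text \<open>The hypothesis to be refuted, at a fixed scale \<open>\<delta>\<close>: nearly equal
  images force the points themselves to be close.\<close>

context
  fixes \<delta> :: real
  assumes \<delta>: "\<delta> > 0"
    and small_fibres: "\<And>x z i. x \<in> Q \<Longrightarrow> z \<in> Q \<Longrightarrow> D x z \<le> \<delta> \<Longrightarrow> i < m \<Longrightarrow> \<bar>x i - z i\<bar> \<le> 1/2"
begin

text \<open>Up to the shift by \<open>1/4\<close>, a McShane extension of the coordinate \<open>z \<mapsto> z i\<close> as a Lipschitz function of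
  \<open>N z\<close>; small fibres keep it within \<open>1/4\<close> of \<open>z i\<close>.\<close>

definition h :: "nat \<Rightarrow> (nat \<Rightarrow> real) \<Rightarrow> real" where
  "h i z = (INF x\<in>Q. x i + D z x / \<delta>) + 1/4"

lemma h_bdd: "i < m \<Longrightarrow> bdd_below ((\<lambda>x. x i + D z x / \<delta>) ` Q)"
  using D_nonneg \<delta> by (intro bdd_belowI2[where m=0]) (auto simp: Q_def)

lemma h_upper: "i < m \<Longrightarrow> z \<in> Q \<Longrightarrow> h i z \<le> z i + 1/4"
  using cINF_lower[OF h_bdd[of i z], of z] by (simp add: h_def D_def)

lemma Q_nonempty: "Q \<noteq> {}"
  by (auto simp: Q_def intro!: exI[of _ "\<lambda>_. 0"])

text \<open>Points \<open>x\<close> with \<open>D z x \<le> \<delta>\<close> are controlled by small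
  fibres; for all others the penalty \<open>D z x / \<delta>\<close> exceeds 1, the length of the
  coordinate interval. The shift by 1/4 in \<open>h\<close> centres the resulting one-sided error of
  1/2.\<close>

lemma h_lower:
  assumes i: "i < m" and z: "z \<in> Q"
  shows "z i - 1/4 \<le> h i z"
proof -
  have "z i - 1/2 \<le> x i + D z x / \<delta>" if x: "x \<in> Q" for x
  proof (cases "D z x \<le> \<delta>")
    case True
    then have "\<bar>z i - x i\<bar> \<le> 1/2" using small_fibres x z i by blast
    then show ?thesis using D_nonneg[of z x] \<delta> by (smt (verit) divide_nonneg_pos)
  next
    case False
    then have "1 \<le> D z x / \<delta>" using \<delta> by simp
    moreover have "z i \<le> 1" "0 \<le> x i" using x z i by (auto simp: Q_def)
    ultimately show ?thesis by linarith
  qed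
  then have "z i - 1/2 \<le> (INF x\<in>Q. x i + D z x / \<delta>)"
    by (intro cINF_greatest Q_nonempty)
  then show ?thesis by (simp add: h_def)
qed

lemma h_lipschitz_one_sided: "i < m \<Longrightarrow> h i z \<le> h i z' + D z z' / \<delta>"
proof -
  assume i: "i < m"
  have "(INF x\<in>Q. x i + D z x / \<delta>) - D z z' / \<delta> \<le> x i + D z' x / \<delta>" if x: "x \<in> Q" for x
  proof -
    have "(INF x\<in>Q. x i + D z x / \<delta>) \<le> x i + D z x / \<delta>"
      using cINF_lower[OF h_bdd[OF i] x] .
    moreover have "D z x / \<delta> \<le> D z z' / \<delta> + D z' x / \<delta>"
      using D_triangle[of z x z'] \<delta> by (simp add: divide_right_mono add_divide_distrib[symmetric])
    ultimately show ?thesis by linarith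
  qed
  then have "(INF x\<in>Q. x i + D z x / \<delta>) - D z z' / \<delta> \<le> (INF x\<in>Q. x i + D z' x / \<delta>)"
    by (intro cINF_greatest Q_nonempty)
  then show ?thesis by (simp add: h_def)
qed

lemma h_lipschitz: "i < m \<Longrightarrow> \<bar>h i z - h i z'\<bar> \<le> D z z' / \<delta>"
  using h_lipschitz_one_sided[of i z z'] h_lipschitz_one_sided[of i z' z] D_commute[of z z'] by simp

text \<open>A discrete Poincare-Miranda argument. A grid point gets label 0 in direction
  \<open>i\<close> if \<open>h i\<close> is below \<open>t i\<close> there. Since \<open>h i\<close>
  stays within 1/4 of the coordinate, the labels are correct on opposite faces, and Kuhn's lemma
  yields a grid cell on which both labels occur in every direction.\<close>

lemma h_hits:
  assumes t: "\<And>i. i < m \<Longrightarrow> 1/4 < t i \<and> t i < 3/4" and \<eta>: "\<eta> > 0"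
  shows "\<exists>z\<in>Q. \<forall>i<m. \<bar>h i z - t i\<bar> \<le> \<eta>"
proof -
  \<comment> \<open>With mesh at most \<open>\<rho>\<close> every \<open>h i\<close>, being
    Lipschitz with constant \<open>1 / \<delta>\<close> in \<open>D\<close>, varies by at most
    \<open>\<eta>\<close> between a cell's base point and its other grid points.\<close>
  obtain \<rho> where \<rho>: "\<rho> > 0" and unif: "\<And>x y. x \<in> Q \<Longrightarrow> y \<in> Q \<Longrightarrow> (\<forall>i<m. \<bar>x i - y i\<bar> \<le> \<rho>) \<Longrightarrow> D x y < \<eta> * \<delta>"
    using D_uniformly_continuous[of "\<eta> * \<delta>"] \<eta> \<delta> by auto
  obtain p0 :: nat where p0: "1 / real (Suc p0) < \<rho>" using \<rho> nat_approx_posE by blast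
  define p where "p = Suc p0"
  have p: "p > 0" "1 / real p \<le> \<rho>" using p0 by (auto simp: p_def)
  define pt :: "(nat \<Rightarrow> nat) \<Rightarrow> nat \<Rightarrow> real" where "pt x = (\<lambda>i. real (x i) / real p)" for x
  have ptQ: "pt x \<in> Q" if "\<forall>i<m. x i \<le> p" for x
    using that p by (auto simp: pt_def Q_def)
  define label :: "(nat \<Rightarrow> nat) \<Rightarrow> nat \<Rightarrow> nat" where "label x i = (if h i (pt x) < t i then 0 else 1)" for x i
  obtain q where q: "\<forall>i<m. q i < p"
    and qq: "\<forall>i<m. \<exists>r s. (\<forall>j<m. q j \<le> r j \<and> r j \<le> q j + 1) \<and> (\<forall>j<m. q j \<le> s j \<and> s j \<le> q j + 1) \<and> label r i \<noteq> label s i"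
  proof (rule kuhn_lemma[OF p(1), of m label])
    show "\<forall>x. (\<forall>i<m. x i \<le> p) \<longrightarrow> (\<forall>i<m. label x i = 0 \<or> label x i = 1)" by (auto simp: label_def)
    show "\<forall>x. (\<forall>i<m. x i \<le> p) \<longrightarrow> (\<forall>i<m. x i = 0 \<longrightarrow> label x i = 0)"
    proof (intro allI impI)
      fix x i assume "\<forall>i<m. x i \<le> p" "i < m" "x i = 0"
      then have "h i (pt x) \<le> 1/4" using h_upper[of i "pt x"] ptQ[of x] by (simp add: pt_def)
      then show "label x i = 0" using t[OF \<open>i < m\<close>] by (auto simp: label_def)
    qed
    show "\<forall>x. (\<forall>i<m. x i \<le> p) \<longrightarrow> (\<forall>i<m. x i = p \<longrightarrow> label x i = 1)"
    proof (intro allI impI)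
      fix x i assume "\<forall>i<m. x i \<le> p" "i < m" "x i = p"
      then have "h i (pt x) \<ge> 3/4" using h_lower[of i "pt x"] ptQ[of x] p by (simp add: pt_def)
      then show "label x i = 1" using t[OF \<open>i < m\<close>] by (auto simp: label_def)
    qed
  qed
  have near: "pt r \<in> Q \<and> (\<forall>i<m. \<bar>h i (pt q) - h i (pt r)\<bar> \<le> \<eta>)"
    if r: "\<forall>j<m. q j \<le> r j \<and> r j \<le> q j + 1" for r
  proof -
    have rQ: "pt r \<in> Q" using r q by (intro ptQ) (auto simp: Suc_le_eq le_less_trans intro: order_trans[of _ "Suc (q _)"])
    have qQ: "pt q \<in> Q" using q by (intro ptQ) auto
    have "\<bar>pt q i - pt r i\<bar> \<le> \<rho>" if "i < m" for i
    proof -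
      have "\<bar>pt q i - pt r i\<bar> = \<bar>real (q i) - real (r i)\<bar> / real p"
        using p by (simp add: pt_def diff_divide_distrib[symmetric])
      also have "\<dots> \<le> 1 / real p" using r that p by (intro divide_right_mono) auto
      finally show ?thesis using p by simp
    qed
    then have "D (pt q) (pt r) < \<eta> * \<delta>" using unif qQ rQ by blast
    then have "D (pt q) (pt r) / \<delta> \<le> \<eta>" using \<delta> by (simp add: field_simps)
    then show ?thesis using h_lipschitz[of _ "pt q" "pt r"] rQ by force
  qed
  have "\<bar>h i (pt q) - t i\<bar> \<le> \<eta>" if i: "i < m" for i
  proof -
    obtain r s where r: "\<forall>j<m. q j \<le> r j \<and> r j \<le> q j + 1" and s: "\<forall>j<m. q j \<le> s j \<and> s j \<le> q j + 1"
      and "label r i \<noteq> label s i" using qq i by blast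
    then have "h i (pt r) < t i \<and> t i \<le> h i (pt s) \<or> h i (pt s) < t i \<and> t i \<le> h i (pt r)"
      by (auto simp: label_def split: if_splits)
    \<comment> \<open>\<open>t i\<close> lies between two values of \<open>h i\<close> that are both
      within \<open>\<eta>\<close> of its value at \<open>q\<close>.\<close>
    then show ?thesis using near[OF r] near[OF s] i by (smt (verit))
  qed
  moreover have "pt q \<in> Q" using q by (intro ptQ) auto
  ultimately show ?thesis by blast
qed

text \<open>The map \<open>h\<close> comes close to all \<open>M ^ m\<close> points of a grid, but it is a Lipschitz function of \<open>n < m\<close> bounded
  parameters, so it separates only \<open>O(M ^ n)\<close> points at that scale.\<close>

lemma small_fibres_contradiction: False
proof -
  obtain R where R: "R \<ge> 0" and NR: "\<And>x k. x \<in> Q \<Longrightarrow> k < n \<Longrightarrow> \<bar>N x k\<bar> \<le> R"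
    using N_bounded by blast
  \<comment> \<open>\<open>Z\<close> does not depend on \<open>M\<close> and leaves at most
    \<open>(2 * Z + 2) * M\<close> bins per parameter. \<open>M\<close> is chosen above
    \<open>(2 * Z + 2) ^ n\<close>, so that \<open>M * M ^ n\<close> exceeds the total number of
    bins.\<close>
  obtain Z :: nat where Z: "8 * R * (real n + 1) / \<delta> \<le> real Z" using real_arch_simple by blast
  define M :: nat where "M = (2 * Z + 2) ^ n + 1"
  have M: "M > 0" by (simp add: M_def)
  \<comment> \<open>The interval from 1/4 to 3/4 is cut into \<open>M\<close> cells of length
    \<open>\<sigma>\<close>, with midpoints \<open>t\<close>. Points in a common bin of width
    \<open>w\<close> satisfy \<open>D \<le> \<sigma> * \<delta> / 4\<close>; dividing by
    \<open>n + 1\<close> instead of \<open>n\<close> covers \<open>n = 0\<close>.\<close>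
  define \<sigma> :: real where "\<sigma> = 1 / (2 * real M)"
  define w where "w = \<sigma> * \<delta> / (4 * (real n + 1))"
  have \<sigma>: "\<sigma> > 0" using M by (simp add: \<sigma>_def)
  have w: "w > 0" using \<sigma> \<delta> by (simp add: w_def)
  define t :: "(nat \<Rightarrow> nat) \<Rightarrow> nat \<Rightarrow> real" where "t a i = 1/4 + (real (a i) + 1/2) * \<sigma>" for a i
  define T where "T = (PiE {..<m} (\<lambda>_. {..<M}))"
  have "\<exists>z\<in>Q. \<forall>i<m. \<bar>h i z - t a i\<bar> \<le> \<sigma>/8" if "a \<in> T" for a
  proof (rule h_hits)
    fix i assume "i < m"
    then have "a i < M" using that by (auto simp: T_def)
    then have "real (a i) + 1/2 < real M" by linarith
    then have "(real (a i) + 1/2) * \<sigma> < real M * \<sigma>" using \<sigma> by (rule mult_strict_right_mono)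
    moreover have "real M * \<sigma> = 1/2" using M by (simp add: \<sigma>_def)
    moreover have "0 < (real (a i) + 1/2) * \<sigma>" using \<sigma> by (simp add: add_nonneg_pos)
    ultimately show "1/4 < t a i \<and> t a i < 3/4" unfolding t_def by linarith
  qed (use \<sigma> in simp)
  then obtain z where zQ: "\<And>a. a \<in> T \<Longrightarrow> z a \<in> Q" and zh: "\<And>a i. a \<in> T \<Longrightarrow> i < m \<Longrightarrow> \<bar>h i (z a) - t a i\<bar> \<le> \<sigma>/8"
    by metis
  define bin where "bin a = restrict (\<lambda>k. \<lfloor>N (z a) k / w\<rfloor>) {..<n}" for a
  define W :: int where "W = int (Z * M) + 1"
  have Rw: "R / w \<le> real (Z * M)"
  proof -
    have "R / w = 8 * R * (real n + 1) / \<delta> * real M"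
      using M \<delta> by (simp add: w_def \<sigma>_def field_simps)
    also have "\<dots> \<le> real Z * real M" using Z by (intro mult_right_mono) auto
    finally show ?thesis by simp
  qed
  have "bin ` T \<subseteq> PiE {..<n} (\<lambda>_. {-W..<W})"
  proof (rule image_subsetI)
    fix a assume a: "a \<in> T"
    have "\<lfloor>N (z a) k / w\<rfloor> \<in> {-W..<W}" if k: "k < n" for k
    proof -
      have "\<bar>N (z a) k / w\<bar> \<le> R / w" using NR[OF zQ[OF a] k] w by (simp add: divide_right_mono)
      then have "\<bar>N (z a) k / w\<bar> \<le> real_of_int (int (Z * M))" using Rw by simp
      then have "\<lfloor>N (z a) k / w\<rfloor> \<le> int (Z * M)" "- int (Z * M) \<le> \<lfloor>N (z a) k / w\<rfloor>"
        unfolding abs_le_iff by (auto simp: floor_le_iff le_floor_iff)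
      then show ?thesis unfolding W_def by simp
    qed
    then show "bin a \<in> PiE {..<n} (\<lambda>_. {-W..<W})" by (auto simp: bin_def)
  qed
  moreover have "inj_on bin T"
  proof (rule inj_onI)
    fix a b assume a: "a \<in> T" and b: "b \<in> T" and eq: "bin a = bin b"
    have close: "\<bar>N (z a) k - N (z b) k\<bar> \<le> w" if "k < n" for k
    proof -
      have "\<lfloor>N (z a) k / w\<rfloor> = \<lfloor>N (z b) k / w\<rfloor>"
        using fun_cong[OF eq, of k] that by (simp add: bin_def)
      then have "\<bar>N (z a) k / w - N (z b) k / w\<bar> \<le> 1" by linarith
      then have "\<bar>(N (z a) k - N (z b) k) / w\<bar> \<le> 1" by (simp add: diff_divide_distrib)
      then show ?thesis using w by (simp add: abs_divide)
    qed
    have "D (z a) (z b) \<le> (\<Sum>k<n. w)" unfolding D_def by (intro sum_mono close) auto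
    also have "\<dots> \<le> \<sigma> * \<delta> / 4"
    proof -
      have "real n * w \<le> (real n + 1) * w" using w by simp
      also have "\<dots> = \<sigma> * \<delta> / 4"
        using nonzero_mult_div_cancel_left[of "real n + 1" "\<sigma> * \<delta> / 4"] by (simp add: w_def field_simps)
      finally show ?thesis by simp
    qed
    finally have D: "D (z a) (z b) / \<delta> \<le> \<sigma> / 4" using \<delta> by (simp add: field_simps)
    \<comment> \<open>Within a bin \<open>h i\<close> moves by at most \<open>\<sigma>/4\<close>,
      and each grid point is hit up to \<open>\<sigma>/8\<close>; the total
      \<open>\<sigma>/2\<close> is less than the spacing.\<close>
    have "a i = b i" if i: "i < m" for i
    proof (rule ccontr)
      assume "a i \<noteq> b i"
      then have "1 \<le> \<bar>real (a i) - real (b i)\<bar>" by linarith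
      then have "\<sigma> \<le> \<bar>real (a i) - real (b i)\<bar> * \<sigma>" using \<sigma> by simp
      also have "\<dots> = \<bar>t a i - t b i\<bar>" using \<sigma> by (simp add: t_def left_diff_distrib[symmetric] abs_mult)
      also have "\<dots> \<le> \<sigma>/8 + \<sigma>/4 + \<sigma>/8"
        using zh[OF a i] zh[OF b i] h_lipschitz[OF i, of "z a" "z b"] D by linarith
      finally show False using \<sigma> by simp
    qed
    then show "a = b" using a b unfolding T_def by (intro PiE_ext[of a "{..<m}" _ b]) auto
  qed
  ultimately have "card T \<le> card (PiE {..<n} (\<lambda>_. {-W..<W}))"
    by (intro card_inj_on_le[of bin]) (auto intro!: finite_PiE)
  then have "M ^ m \<le> (nat (2 * W)) ^ n" by (simp add: T_def card_PiE)
  also have "nat (2 * W) \<le> (2 * Z + 2) * M" using M by (simp add: W_def nat_le_iff algebra_simps)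
  then have "(nat (2 * W)) ^ n \<le> ((2 * Z + 2) * M) ^ n" by (rule power_mono) simp
  also have "\<dots> = (2 * Z + 2) ^ n * M ^ n" by (rule power_mult_distrib)
  finally have "M ^ m \<le> (2 * Z + 2) ^ n * M ^ n" .
  moreover have "M * M ^ n \<le> M ^ m"
    using M dims power_increasing[of "Suc n" m M] by simp
  ultimately have "M * M ^ n \<le> (2 * Z + 2) ^ n * M ^ n" by linarith
  then have "M \<le> (2 * Z + 2) ^ n" using M by simp
  then show False by (simp add: M_def)
qed

end

text \<open>By \<open>small_fibres_contradiction\<close> there are pairs that stay 1/2 apart in some
  coordinate while their images approach each other. Along a subsequence both members converge, and
  the limits have equal images. Were the limits closer than 1/2 in each of the finitely many
  coordinates, so would be the pairs eventually.\<close>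

theorem large_fibre:
  "\<exists>x\<in>Q. \<exists>z\<in>Q. (\<forall>k<n. N x k = N z k) \<and> (\<exists>i<m. 1/2 \<le> \<bar>x i - z i\<bar>)"
proof (rule ccontr)
  assume neg: "\<not> ?thesis"
  have "\<exists>x\<in>Q. \<exists>z\<in>Q. D x z \<le> 1 / real (Suc j) \<and> (\<exists>i<m. 1/2 \<le> \<bar>x i - z i\<bar>)" for j
    using small_fibres_contradiction[of "1 / real (Suc j)"] by force
  then obtain X Z I where X: "\<And>j. X j \<in> Q" and Z: "\<And>j. Z j \<in> Q"
    and XZ: "\<And>j. D (X j) (Z j) \<le> 1 / real (Suc j)" and I: "\<And>j. I j < m \<and> 1/2 \<le> \<bar>X j (I j) - Z j (I j)\<bar>"
    by metis
  obtain r l where r: "strict_mono (r :: nat \<Rightarrow> nat)" and l: "l \<in> Q"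
    and lim: "\<And>i. i < m \<Longrightarrow> (\<lambda>j. X (r j) i) \<longlonglongrightarrow> l i"
    and N: "\<And>k. k < n \<Longrightarrow> (\<lambda>j. N (X (r j)) k) \<longlonglongrightarrow> N l k"
    using convergent_subsequence[of X] X by metis
  obtain s l' where s: "strict_mono (s :: nat \<Rightarrow> nat)" and l': "l' \<in> Q"
    and lim': "\<And>i. i < m \<Longrightarrow> (\<lambda>j. Z (r (s j)) i) \<longlonglongrightarrow> l' i"
    and N': "\<And>k. k < n \<Longrightarrow> (\<lambda>j. N (Z (r (s j))) k) \<longlonglongrightarrow> N l' k"
    using convergent_subsequence[of "\<lambda>j. Z (r j)"] Z by metis
  have lim2: "(\<lambda>j. X (r (s j)) i) \<longlonglongrightarrow> l i" if "i < m" for i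
    using LIMSEQ_subseq_LIMSEQ[OF lim[OF that] s] by (simp add: o_def)
  have N2: "(\<lambda>j. N (X (r (s j))) k) \<longlonglongrightarrow> N l k" if "k < n" for k
    using LIMSEQ_subseq_LIMSEQ[OF N[OF that] s] by (simp add: o_def)
  have "N l k = N l' k" if k: "k < n" for k
  proof -
    have "(\<lambda>j. N (X (r (s j))) k - N (Z (r (s j))) k) \<longlonglongrightarrow> 0"
    proof (rule Lim_null_comparison)
      show "\<forall>\<^sub>F j in sequentially. norm (N (X (r (s j))) k - N (Z (r (s j))) k) \<le> 1 / real (Suc (r (s j)))"
        using order_trans[OF D_ge[OF k] XZ] by simp
      show "(\<lambda>j. 1 / real (Suc (r (s j)))) \<longlonglongrightarrow> 0"
        using LIMSEQ_subseq_LIMSEQ[OF LIMSEQ_inverse_real_of_nat strict_mono_o[OF r s]]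
        by (simp add: o_def inverse_eq_divide)
    qed
    moreover have "(\<lambda>j. N (X (r (s j))) k - N (Z (r (s j))) k) \<longlonglongrightarrow> N l k - N l' k"
      by (intro tendsto_diff N2 N' k)
    ultimately show ?thesis using LIMSEQ_unique by fastforce
  qed
  with neg l l' have small: "\<bar>l i - l' i\<bar> < 1/2" if "i < m" for i using that by (meson not_le)
  have "\<forall>\<^sub>F j in sequentially. \<forall>i\<in>{..<m}. \<bar>X (r (s j)) i - Z (r (s j)) i\<bar> < 1/2"
    by (intro eventually_ball_finite ballI order_tendstoD(2)[OF tendsto_rabs[OF tendsto_diff[OF lim2 lim']]])
       (use small in auto)
  then obtain j where "\<forall>i\<in>{..<m}. \<bar>X (r (s j)) i - Z (r (s j)) i\<bar> < 1/2"
    by (auto simp: eventually_sequentially)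
  with I[of "r (s j)"] show False by force
qed

end

section \<open>The supremum norm on the cube\<close>

lemma space_cube_measure [simp]: "space (cube_measure d) = cube d"
  by (simp add: cube_measure_def cube_def space_PiM)

lemma cube_upd: "x \<in> cube d \<Longrightarrow> j \<in> {1..d} \<Longrightarrow> t \<in> {0..1} \<Longrightarrow> x(j := t) \<in> cube d"
  unfolding cube_def by (auto simp: PiE_iff extensional_def)

lemma cube_coordinate: "x \<in> cube d \<Longrightarrow> j \<in> {1..d} \<Longrightarrow> x j \<in> {0..1}"
  unfolding cube_def by (rule PiE_mem)

text \<open>Measurability into \<open>nat \<Rightarrow> real\<close> can be checked per coordinate,
  so the inclusion of the cube is Borel measurable; coordinates outside \<open>{1..d}\<close> are
  constantly \<open>undefined\<close>.\<close>

lemma borel_measurable_continuous_on_cube: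
  assumes "continuous_on (cube d) g"
  shows "g \<in> borel_measurable (cube_measure d)"
proof -
  let ?P = "PiM {1..d} (\<lambda>_. restrict_space lborel {0..1::real})"
  have "(\<lambda>x. x) \<in> borel_measurable ?P"
  proof (rule measurable_coordinatewise_then_product)
    fix i show "(\<lambda>x. x i) \<in> borel_measurable ?P"
    proof (cases "i \<in> {1..d}")
      case True
      have "(\<lambda>x. x i) \<in> measurable ?P (restrict_space lborel {0..1})"
        by (rule measurable_component_singleton[OF True])
      then show ?thesis by (simp add: measurable_restrict_space2_iff)
    next
      case False
      then have "x i = undefined" if "x \<in> space ?P" for x
        using that by (auto simp: space_PiM PiE_iff extensional_def)
      then show ?thesis by (subst measurable_cong[where g="\<lambda>_. undefined"]) auto
    qed
  qed
  then have "(\<lambda>x. x) \<in> measurable ?P (restrict_space borel (cube d))"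
    by (auto simp: measurable_restrict_space2_iff space_PiM cube_def)
  moreover have "g \<in> borel_measurable (restrict_space borel (cube d))"
    by (rule borel_measurable_continuous_on_restrict[OF assms])
  ultimately have "(\<lambda>x. g x) \<in> borel_measurable ?P"
    by (rule measurable_compose)
  then show ?thesis unfolding cube_measure_def by (rule measurable_completion)
qed

lemma box_measure_pos:
  assumes x: "x \<in> cube d" and r: "r > 0"
  shows "emeasure (PiM {1..d} (\<lambda>_. restrict_space lborel {0..1::real})) (PiE {1..d} (\<lambda>i. {x i - r<..<x i + r} \<inter> {0..1})) > 0"
proof -
  let ?A = "\<lambda>i. {x i - r<..<x i + r} \<inter> {0..1}"
  interpret product_sigma_finite "\<lambda>_::nat. restrict_space lborel {0..1::real}"
    by (intro product_sigma_finite.intro sigma_finite_measure_restrict_space sigma_finite_lborel) simp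
  have pos: "0 < emeasure (restrict_space lborel {0..1::real}) (?A i)" if "i \<in> {1..d}" for i
  proof -
    define a b where "a = max 0 (x i - r / 2)" and "b = min 1 (x i + r / 2)"
    have xi: "x i \<in> {0..1}" using x that by (auto simp: cube_def)
    have "a < b" using xi r by (auto simp: a_def b_def)
    then have "0 < emeasure lborel {a..b}" by simp
    also have "\<dots> \<le> emeasure lborel (?A i)"
      using r xi by (intro emeasure_mono) (auto simp: a_def b_def)
    also have "\<dots> = emeasure (restrict_space lborel {0..1::real}) (?A i)"
      by (subst emeasure_restrict_space) auto
    finally show ?thesis .
  qed
  have "emeasure (PiM {1..d} (\<lambda>_. restrict_space lborel {0..1::real})) (PiE {1..d} ?A)
      = (\<Prod>i\<in>{1..d}. emeasure (restrict_space lborel {0..1::real}) (?A i))"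
    by (intro emeasure_PiM) (auto simp: sets_restrict_space)
  also have "\<dots> > 0" using pos by (force simp: zero_less_iff_neq_zero prod_zero_iff)
  finally show ?thesis .
qed

text \<open>A basic open set of the product topology restricts the coordinates separately. Outside
  \<open>{1..d}\<close> all points of the box agree with \<open>x\<close>, so only finitely many
  radii matter.\<close>

lemma open_contains_box:
  assumes U: "open U" "x \<in> U" and x: "x \<in> cube d"
  shows "\<exists>r>0. PiE {1..d} (\<lambda>i. {x i - r<..<x i + r} \<inter> {0..1}) \<subseteq> U"
proof -
  have "openin (product_topology (\<lambda>i. euclidean) UNIV) U"
    using U(1) by (simp add: open_fun_def)
  from product_topology_open_contains_basis[OF this U(2)]
  obtain X where X: "x \<in> PiE UNIV X" "\<And>i. open (X i)" "PiE UNIV X \<subseteq> U" by auto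
  have "\<exists>r>0. ball (x i) r \<subseteq> X i" for i
    using X(1,2) open_contains_ball by (metis PiE_UNIV_domain PiE_mem UNIV_I)
  then obtain \<rho> where \<rho>: "\<And>i. \<rho> i > 0" "\<And>i. ball (x i) (\<rho> i) \<subseteq> X i" by metis
  \<comment> \<open>The inserted 1 keeps the minimum meaningful for \<open>d = 0\<close>.\<close>
  define r where "r = Min (insert 1 (\<rho> ` {1..d}))"
  have r: "r > 0" "\<And>i. i \<in> {1..d} \<Longrightarrow> r \<le> \<rho> i" using \<rho>(1) Min_le[of "insert 1 (\<rho> ` {1..d})"] by (auto simp: r_def)
  have "z i \<in> X i" if z: "z \<in> PiE {1..d} (\<lambda>i. {x i - r<..<x i + r} \<inter> {0..1})" for z i
  proof (cases "i \<in> {1..d}")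
    case True
    then have "z i \<in> {x i - r<..<x i + r}" using z by (auto simp: PiE_iff)
    then have "z i \<in> ball (x i) (\<rho> i)" using r(2)[OF True] by (auto simp: dist_real_def abs_less_iff)
    then show ?thesis using \<rho>(2) by blast
  next
    case False
    have "z i = x i" using PiE_arb[OF z False] PiE_arb[OF x[unfolded cube_def] False] by simp
    then show ?thesis using PiE_mem[OF X(1), of i] by simp
  qed
  then show ?thesis using r(1) by (intro exI[of _ r]) (auto intro!: subsetD[OF X(3)])
qed

text \<open>Where a continuous function exceeds the bound, it does so on a whole box, which has
  positive measure. This turns essential suprema into pointwise bounds.\<close>

lemma continuous_AE_bound:
  assumes g: "continuous_on (cube d) g" and ae: "AE x in cube_measure d. ereal \<bar>g x\<bar> \<le> B" and x: "x \<in> cube d"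
  shows "ereal \<bar>g x\<bar> \<le> B"
proof (rule ccontr)
  assume "\<not> ?thesis"
  then have "B < ereal \<bar>g x\<bar>" by simp
  then obtain y where y: "B < ereal y" "ereal y < ereal \<bar>g x\<bar>"
    using ereal_dense2 by blast
  have "continuous_on (cube d) (\<lambda>x. \<bar>g x\<bar>)" using g by (intro continuous_intros)
  moreover have "open {y<..}" by simp
  ultimately obtain U where U: "open U" "U \<inter> cube d = (\<lambda>x. \<bar>g x\<bar>) -` {y<..} \<inter> cube d"
    unfolding continuous_on_open_invariant by blast
  have "x \<in> U" using U y x by auto
  obtain r where r: "r > 0" and sub: "PiE {1..d} (\<lambda>i. {x i - r<..<x i + r} \<inter> {0..1}) \<subseteq> U"
    using open_contains_box[OF U(1) \<open>x \<in> U\<close> x] by blast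
  let ?A = "PiE {1..d} (\<lambda>i. {x i - r<..<x i + r} \<inter> {0..1})"
  let ?P = "PiM {1..d} (\<lambda>_. restrict_space lborel {0..1::real})"
  have A: "?A \<in> sets ?P" by (intro sets_PiM_I_finite) (auto simp: sets_restrict_space)
  have "?A \<subseteq> cube d" by (auto simp: cube_def PiE_iff)
  have gB: "ereal \<bar>g z\<bar> > B" if "z \<in> ?A" for z
  proof -
    have "z \<in> (\<lambda>x. \<bar>g x\<bar>) -` {y<..} \<inter> cube d" using that sub \<open>?A \<subseteq> cube d\<close> U(2) by blast
    then have "y < \<bar>g z\<bar>" by simp
    then show ?thesis using y(1) by (meson less_ereal.simps(1) less_trans)
  qed
  have "AE z in cube_measure d. z \<notin> ?A"
    using ae by (rule eventually_mono) (use gB in \<open>auto simp: not_le[symmetric]\<close>)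
  then have "AE z in ?P. z \<notin> ?A" unfolding cube_measure_def by (simp add: AE_completion_iff)
  moreover have "{z \<in> space ?P. \<not> z \<notin> ?A} = ?A" using sets.sets_into_space[OF A] by auto
  ultimately have "emeasure ?P ?A = 0" using A by (subst (asm) AE_iff_measurable[of ?A]) auto
  with box_measure_pos[OF x r] show False by simp
qed

lemma Linf_norm_ge:
  assumes "continuous_on (cube d) g" "x \<in> cube d"
  shows "ereal \<bar>g x\<bar> \<le> Linf_norm d g"
  unfolding Linf_norm_def by (rule continuous_AE_bound[OF assms(1) esssup_AE assms(2)])

lemma Linf_norm_le:
  assumes "continuous_on (cube d) g" "\<And>x. x \<in> cube d \<Longrightarrow> \<bar>g x\<bar> \<le> B"
  shows "Linf_norm d g \<le> ereal B"
  unfolding Linf_norm_def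
  by (intro esssup_I borel_measurable_ereal borel_measurable_abs borel_measurable_continuous_on_cube assms(1))
     (use assms(2) in \<open>auto\<close>)

lemma continuous_bounded_Linf:
  assumes "continuous_on (cube d) g" "\<And>x. x \<in> cube d \<Longrightarrow> \<bar>g x\<bar> \<le> B"
  shows "g \<in> Linf d"
  using Linf_norm_le[OF assms] borel_measurable_continuous_on_cube[OF assms(1)]
  unfolding Linf_def by auto

text \<open>The two bounds through \<open>g\<close> hold only almost everywhere; continuity of the
  difference of \<open>f\<close> and \<open>f'\<close> upgrades the combined bound to every
  point.\<close>

lemma Linf_dist_triangle:
  assumes f: "continuous_on (cube d) f" and f': "continuous_on (cube d) f'" and x: "x \<in> cube d"
    and a: "Linf_norm d (\<lambda>x. f x - g x) \<le> ereal a" and b: "Linf_norm d (\<lambda>x. f' x - g x) \<le> ereal b"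
  shows "\<bar>f x - f' x\<bar> \<le> a + b"
proof -
  have "AE x in cube_measure d. ereal \<bar>f x - g x\<bar> \<le> ereal a"
    using esssup_AE[of "\<lambda>x. ereal \<bar>f x - g x\<bar>" "cube_measure d"]
    by (rule eventually_mono) (rule order_trans[OF _ a[unfolded Linf_norm_def]])
  moreover have "AE x in cube_measure d. ereal \<bar>f' x - g x\<bar> \<le> ereal b"
    using esssup_AE[of "\<lambda>x. ereal \<bar>f' x - g x\<bar>" "cube_measure d"]
    by (rule eventually_mono) (rule order_trans[OF _ b[unfolded Linf_norm_def]])
  ultimately have "AE x in cube_measure d. ereal \<bar>f x - f' x\<bar> \<le> ereal (a + b)"
    by eventually_elim auto
  with continuous_AE_bound[OF continuous_on_diff[OF f f'] this x] show ?thesis by simp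
qed

section \<open>Iterated partial derivatives and Taylor series\<close>

text \<open>Distributivity for infinitely many summands, splitting off one factor at a time;
  nonnegativity makes the resulting double sum summable.\<close>

lemma has_sum_prod_PiE:
  fixes f :: "'a \<Rightarrow> 'b \<Rightarrow> real"
  assumes "finite A" and "\<And>x k. x \<in> A \<Longrightarrow> 0 \<le> f x k" and "\<And>x. x \<in> A \<Longrightarrow> (f x has_sum s x) UNIV"
  shows "((\<lambda>g. \<Prod>x\<in>A. f x (g x)) has_sum (\<Prod>x\<in>A. s x)) (PiE A (\<lambda>_. UNIV))"
  using assms
proof (induction A rule: finite_induct)
  case empty
  show ?case using has_sum_finite[of "{\<lambda>_. undefined}" "\<lambda>_. 1 :: real"] by simp
next
  case (insert x A)
  let ?h = "\<lambda>(k, g). g(x := k)"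
  let ?P = "PiE A (\<lambda>_. UNIV :: 'b set)"
  have IH: "((\<lambda>g. \<Prod>x\<in>A. f x (g x)) has_sum (\<Prod>x\<in>A. s x)) ?P"
    using insert.prems by (intro insert.IH) auto
  have eq: "(\<Prod>y\<in>insert x A. f y ((g(x := k)) y)) = f x k * (\<Prod>y\<in>A. f y (g y))" for g k
  proof -
    have "(\<Prod>y\<in>A. f y ((g(x := k)) y)) = (\<Prod>y\<in>A. f y (g y))"
      using insert.hyps by (intro prod.cong) auto
    then show ?thesis using insert.hyps by simp
  qed
  have inner: "((\<lambda>g. f x k * (\<Prod>y\<in>A. f y (g y))) has_sum f x k * (\<Prod>y\<in>A. s y)) ?P" for k
    by (rule has_sum_cmult_right[OF IH])
  have outer: "((\<lambda>k. f x k * (\<Prod>y\<in>A. s y)) has_sum s x * (\<Prod>y\<in>A. s y)) UNIV"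
    using insert.prems by (intro has_sum_cmult_left) auto
  have "((\<lambda>(k, g). f x k * (\<Prod>y\<in>A. f y (g y))) has_sum s x * (\<Prod>y\<in>A. s y)) (Sigma UNIV (\<lambda>_. ?P))"
  proof (rule has_sum_SigmaI)
    show "(\<lambda>(k, g). f x k * (\<Prod>y\<in>A. f y (g y))) summable_on Sigma UNIV (\<lambda>_. ?P)"
    proof (rule summable_on_SigmaI)
      show "(\<lambda>k. f x k * (\<Prod>y\<in>A. s y)) summable_on UNIV" using outer by (rule has_sum_imp_summable)
    qed (use inner insert.prems in \<open>auto intro!: mult_nonneg_nonneg prod_nonneg\<close>)
  qed (use inner outer in auto)
  then have "(((\<lambda>g. \<Prod>y\<in>insert x A. f y (g y)) \<circ> ?h) has_sum s x * (\<Prod>y\<in>A. s y)) (UNIV \<times> ?P)"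
    by (simp only: o_def case_prod_unfold eq)
  then have "((\<lambda>g. \<Prod>y\<in>insert x A. f y (g y)) has_sum s x * (\<Prod>y\<in>A. s y)) (?h ` (UNIV \<times> ?P))"
    using insert.hyps by (subst has_sum_reindex) (auto intro!: inj_combinator[of x A "\<lambda>_. UNIV"])
  then show ?case using insert.hyps by (simp add: PiE_insert_eq del: fun_upd_apply)
qed

section \<open>One-sided partial derivatives and smoothness on the closed cube\<close>

lemma partial_deriv_eqI:
  assumes x: "x \<in> cube d" "j \<in> {1..d}"
    and D: "((\<lambda>t. f (x(j := t))) has_real_derivative D) (at (x j) within {0..1})"
  shows "partial_deriv j f x = D"
proof -
  have "x j \<in> {0..1}" using x by (auto simp: cube_def)
  then show ?thesis unfolding partial_deriv_def
    using D vector_derivative_within_cbox[of 0 1 "x j" "\<lambda>t. f (x(j := t))" D]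
    by (simp add: has_real_derivative_iff_has_vector_derivative)
qed

lemma has_partial_derivD:
  assumes f: "has_partial_deriv_on_cube d j f" and x: "x \<in> cube d" "j \<in> {1..d}" and s: "s \<in> {0..1}"
  shows "((\<lambda>t. f (x(j := t))) has_real_derivative partial_deriv j f (x(j := s))) (at s within {0..1})"
proof -
  have "(\<lambda>t. f ((x(j := s))(j := t))) differentiable (at ((x(j := s)) j) within {0..1})"
    using f cube_upd[OF x s] unfolding has_partial_deriv_on_cube_def by blast
  then show ?thesis
    by (simp add: partial_deriv_def vector_derivative_works has_real_derivative_iff_has_vector_derivative)
qed

lemma has_partial_derivD':
  assumes f: "has_partial_deriv_on_cube d j f" and x: "x \<in> cube d" "j \<in> {1..d}"
  shows "((\<lambda>t. f (x(j := t))) has_real_derivative partial_deriv j f x) (at (x j) within {0..1})"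
  using has_partial_derivD[OF f x cube_coordinate[OF x]] by simp

lemma has_partial_deriv_transform:
  assumes eq: "\<And>y. y \<in> cube d \<Longrightarrow> f y = g y" and x: "x \<in> cube d" "j \<in> {1..d}"
    and D: "((\<lambda>t. g (x(j := t))) has_real_derivative D) (at (x j) within {0..1})"
  shows "((\<lambda>t. f (x(j := t))) has_real_derivative D) (at (x j) within {0..1})"
proof (rule has_field_derivative_transform_within[OF D zero_less_one])
  show "x j \<in> {0..1}" using x by (auto simp: cube_def)
qed (use eq cube_upd[OF x] in auto)

text \<open>The derivative is taken within \<open>{0..1}\<close>, so values off the cube never
  enter.\<close>

lemma partial_deriv_cong:
  assumes eq: "\<And>y. y \<in> cube d \<Longrightarrow> f y = g y" and x: "x \<in> cube d" "j \<in> {1..d}"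
  shows "partial_deriv j f x = partial_deriv j g x"
  unfolding partial_deriv_def
  using x eq cube_upd[OF x] by (intro vector_derivative_cong_eq) (auto simp: cube_def intro!: always_eventually)

text \<open>\<open>B\<close> stands for a bound that differentiation in direction \<open>j\<close>
  multiplies by \<open>w j\<close>. Trivial weights give smoothness; \<open>w = \<gamma> d\<close>
  gives the norm estimate for the test functions of the lower bound.\<close>

lemma foldr_partial_deriv_family:
  assumes der: "\<And>f B j. f \<in> \<Phi> B \<Longrightarrow> j \<in> {1..d} \<Longrightarrow> \<exists>g\<in>\<Phi> (w j * B). \<forall>x\<in>cube d.
      ((\<lambda>t. f (x(j := t))) has_real_derivative g x) (at (x j) within {0..1})"
    and f: "f \<in> \<Phi> B" and js: "set js \<subseteq> {1..d}"
  shows "\<exists>g\<in>\<Phi> (prod_list (map w js) * B). \<forall>x\<in>cube d. foldr partial_deriv js f x = g x"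
  using js
proof (induction js)
  case Nil
  then show ?case using f by auto
next
  case (Cons j js)
  then obtain g where g: "g \<in> \<Phi> (prod_list (map w js) * B)" "\<And>x. x \<in> cube d \<Longrightarrow> foldr partial_deriv js f x = g x"
    by auto
  obtain h where h: "h \<in> \<Phi> (w j * (prod_list (map w js) * B))"
    and D: "\<And>x. x \<in> cube d \<Longrightarrow> ((\<lambda>t. g (x(j := t))) has_real_derivative h x) (at (x j) within {0..1})"
    using der[OF g(1), of j] Cons.prems by auto
  have "foldr partial_deriv (j # js) f x = h x" if x: "x \<in> cube d" for x
    using partial_deriv_cong[OF g(2) x] partial_deriv_eqI[OF x _ D[OF x]] Cons.prems by simp
  then show ?case using h by (auto simp: mult.assoc)
qed

text \<open>Iterated derivatives never leave a family closed under differentiation, up to equality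
  on the cube, so continuity of its members suffices.\<close>

lemma smooth_on_cube_family:
  assumes cont: "\<And>f. f \<in> \<Phi> \<Longrightarrow> continuous_on (cube d) f"
    and der: "\<And>f j. f \<in> \<Phi> \<Longrightarrow> j \<in> {1..d} \<Longrightarrow> \<exists>g\<in>\<Phi>. \<forall>x\<in>cube d.
      ((\<lambda>t. f (x(j := t))) has_real_derivative g x) (at (x j) within {0..1})"
    and f: "f \<in> \<Phi>"
  shows "smooth_on_cube d f"
  unfolding smooth_on_cube_def
proof (intro allI impI conjI ballI)
  fix js assume js: "set js \<subseteq> {1..d}"
  obtain g where g: "g \<in> \<Phi>" "\<And>x. x \<in> cube d \<Longrightarrow> foldr partial_deriv js f x = g x"
    using foldr_partial_deriv_family[of "\<lambda>_. \<Phi>" d "\<lambda>_. 1" f 1 js] der f js by auto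
  show "continuous_on (cube d) (foldr partial_deriv js f)"
    using cont[OF g(1)] g(2) by (subst continuous_on_cong[OF refl, of _ _ g]) auto
  fix j assume j: "j \<in> {1..d}"
  obtain h where D: "\<And>x. x \<in> cube d \<Longrightarrow> ((\<lambda>t. g (x(j := t))) has_real_derivative h x) (at (x j) within {0..1})"
    using der[OF g(1) j] by auto
  show "has_partial_deriv_on_cube d j (foldr partial_deriv js f)"
    unfolding has_partial_deriv_on_cube_def
    using has_partial_deriv_transform[OF g(2) _ j D] unfolding real_differentiable_def by blast
qed

section \<open>Smoothness and mixed derivatives under linear combination; pointwise form of the
  norm\<close>

lemma smooth_foldr: "smooth_on_cube d f \<Longrightarrow> set js \<subseteq> {1..d} \<Longrightarrow> smooth_on_cube d (foldr partial_deriv js f)"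
  unfolding smooth_on_cube_def by (metis foldr_append comp_apply set_append Un_subset_iff)

lemma smooth_continuous: "smooth_on_cube d f \<Longrightarrow> continuous_on (cube d) f"
  unfolding smooth_on_cube_def by (metis empty_set empty_subsetI foldr_Nil id_apply)

lemma smooth_has_partial_deriv: "smooth_on_cube d f \<Longrightarrow> j \<in> {1..d} \<Longrightarrow> has_partial_deriv_on_cube d j f"
  unfolding smooth_on_cube_def by (metis empty_set empty_subsetI foldr_Nil id_apply)

lemma smooth_partial_deriv: "smooth_on_cube d f \<Longrightarrow> j \<in> {1..d} \<Longrightarrow> smooth_on_cube d (partial_deriv j f)"
  using smooth_foldr[of d f "[j]"] by simp

lemma partial_deriv_lincomb:
  assumes "smooth_on_cube d f" "smooth_on_cube d g" "x \<in> cube d" "j \<in> {1..d}"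
  shows "((\<lambda>t. a * f (x(j := t)) + b * g (x(j := t))) has_real_derivative
      a * partial_deriv j f x + b * partial_deriv j g x) (at (x j) within {0..1})"
  by (intro DERIV_add DERIV_cmult has_partial_derivD'[of d] smooth_has_partial_deriv assms)

lemma smooth_lincomb:
  assumes "smooth_on_cube d f" "smooth_on_cube d g"
  shows "smooth_on_cube d (\<lambda>x. a * f x + b * g x)"
proof (rule smooth_on_cube_family[where \<Phi> = "{\<lambda>x. a * f x + b * g x | f g. smooth_on_cube d f \<and> smooth_on_cube d g}"])
  fix h j assume "h \<in> {\<lambda>x. a * f x + b * g x | f g. smooth_on_cube d f \<and> smooth_on_cube d g}" and j: "j \<in> {1..d}"
  then obtain f g where h: "h = (\<lambda>x. a * f x + b * g x)" and fg: "smooth_on_cube d f" "smooth_on_cube d g" by auto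
  show "\<exists>g\<in>{\<lambda>x. a * f x + b * g x | f g. smooth_on_cube d f \<and> smooth_on_cube d g}. \<forall>x\<in>cube d.
      ((\<lambda>t. h (x(j := t))) has_real_derivative g x) (at (x j) within {0..1})"
    unfolding h
    by (rule bexI[of _ "\<lambda>x. a * partial_deriv j f x + b * partial_deriv j g x"])
       (use partial_deriv_lincomb[OF fg _ j] smooth_partial_deriv[OF fg(1) j] smooth_partial_deriv[OF fg(2) j] in auto)
qed (use assms in \<open>auto simp: smooth_continuous intro!: continuous_intros\<close>)

lemma foldr_partial_deriv_lincomb:
  assumes "smooth_on_cube d f" "smooth_on_cube d g" "set js \<subseteq> {1..d}" "x \<in> cube d"
  shows "foldr partial_deriv js (\<lambda>x. a * f x + b * g x) x = a * foldr partial_deriv js f x + b * foldr partial_deriv js g x"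
  using assms(3,4)
proof (induction js arbitrary: x)
  case (Cons j js)
  have "foldr partial_deriv (j # js) (\<lambda>x. a * f x + b * g x) x
      = partial_deriv j (\<lambda>x. a * foldr partial_deriv js f x + b * foldr partial_deriv js g x) x"
    using Cons by (auto intro!: partial_deriv_cong[of d])
  also have "\<dots> = a * foldr partial_deriv (j # js) f x + b * foldr partial_deriv (j # js) g x"
    using Cons.prems assms(1,2) by (auto intro!: partial_deriv_eqI[of _ d] partial_deriv_lincomb smooth_foldr)
  finally show ?case .
qed simp

text \<open>Spells out a multi-index as a list of single directions, the form in which smoothness
  and \<open>foldr_partial_deriv_family\<close> are stated.\<close>

definition multi_list :: "(nat \<Rightarrow> nat) \<Rightarrow> nat list \<Rightarrow> nat list" where
  "multi_list \<alpha> js = concat (map (\<lambda>j. replicate (\<alpha> j) j) js)"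

lemma set_multi_list: "set (multi_list \<alpha> js) \<subseteq> set js"
  by (auto simp: multi_list_def)

lemma foldr_multi_list: "foldr (\<lambda>j. partial_deriv j ^^ \<alpha> j) js f = foldr partial_deriv (multi_list \<alpha> js) f"
  by (induction js) (auto simp: multi_list_def foldr_replicate)

lemma mixed_deriv_eq: "mixed_deriv d \<alpha> f = foldr partial_deriv (multi_list \<alpha> [1..<Suc d]) f"
  by (simp add: mixed_deriv_def foldr_multi_list)

lemma set_multi_list_upt: "set (multi_list \<alpha> [1..<Suc d]) \<subseteq> {1..d}"
  using set_multi_list[of \<alpha> "[1..<Suc d]"] by auto

lemma prod_list_multi_list: "prod_list (map c (multi_list \<alpha> js)) = prod_list (map (\<lambda>j. c j ^ \<alpha> j :: real) js)"
  by (induction js) (auto simp: multi_list_def prod_list_replicate)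

lemma prod_list_weight: "prod_list (map (\<gamma> d) (multi_list \<alpha> [1..<Suc d])) = weight \<gamma> d \<alpha>"
  unfolding prod_list_multi_list weight_def
  by (subst prod.distinct_set_conv_list[symmetric]) (auto intro!: prod.cong)

lemma smooth_mixed_deriv: "smooth_on_cube d f \<Longrightarrow> smooth_on_cube d (mixed_deriv d \<alpha> f)"
  unfolding mixed_deriv_eq by (intro smooth_foldr set_multi_list_upt)

lemma mixed_deriv_lincomb:
  assumes "smooth_on_cube d f" "smooth_on_cube d g" "x \<in> cube d"
  shows "mixed_deriv d \<alpha> (\<lambda>x. a * f x + b * g x) x = a * mixed_deriv d \<alpha> f x + b * mixed_deriv d \<alpha> g x"
  unfolding mixed_deriv_eq by (rule foldr_partial_deriv_lincomb[OF assms(1,2) set_multi_list_upt assms(3)])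

lemma F_norm_le:
  assumes f: "smooth_on_cube d f" and w: "\<And>\<alpha>. weight \<gamma> d \<alpha> > 0"
    and B: "\<And>\<alpha> x. \<alpha> \<in> multi_indices d \<Longrightarrow> x \<in> cube d \<Longrightarrow> \<bar>mixed_deriv d \<alpha> f x\<bar> \<le> weight \<gamma> d \<alpha> * B"
  shows "F_norm \<gamma> d f \<le> ereal B"
  unfolding F_norm_def
proof (rule SUP_least)
  fix \<alpha> assume \<alpha>: "\<alpha> \<in> multi_indices d"
  have "ereal (1 / weight \<gamma> d \<alpha>) * Linf_norm d (mixed_deriv d \<alpha> f) \<le> ereal (1 / weight \<gamma> d \<alpha>) * ereal (weight \<gamma> d \<alpha> * B)"
    using w[of \<alpha>] f B[OF \<alpha>] by (intro ereal_mult_left_mono Linf_norm_le smooth_continuous smooth_mixed_deriv) auto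
  also have "\<dots> = ereal B" using w[of \<alpha>] by simp
  finally show "ereal (1 / weight \<gamma> d \<alpha>) * Linf_norm d (mixed_deriv d \<alpha> f) \<le> ereal B" .
qed

lemma F_norm_ge:
  assumes f: "smooth_on_cube d f" and w: "weight \<gamma> d \<alpha> > 0" and \<alpha>: "\<alpha> \<in> multi_indices d"
    and B: "F_norm \<gamma> d f \<le> ereal B" and x: "x \<in> cube d"
  shows "\<bar>mixed_deriv d \<alpha> f x\<bar> \<le> weight \<gamma> d \<alpha> * B"
proof -
  have "ereal (1 / weight \<gamma> d \<alpha>) * ereal \<bar>mixed_deriv d \<alpha> f x\<bar>
      \<le> ereal (1 / weight \<gamma> d \<alpha>) * Linf_norm d (mixed_deriv d \<alpha> f)"
    using w by (intro ereal_mult_left_mono Linf_norm_ge smooth_continuous smooth_mixed_deriv f x) auto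
  also have "\<dots> \<le> F_norm \<gamma> d f" unfolding F_norm_def by (intro SUP_upper \<alpha>)
  also have "\<dots> \<le> ereal B" by (rule B)
  finally show ?thesis using w by (simp add: field_simps)
qed

section \<open>Taylor series, first in one coordinate and then in all\<close>

lemma partial_Taylor_sums:
  assumes g: "smooth_on_cube d g" and x: "x \<in> cube d" "j \<in> {1..d}"
    and bnd: "\<And>k y. y \<in> cube d \<Longrightarrow> \<bar>(partial_deriv j ^^ k) g y\<bar> \<le> B * c ^ k"
  shows "(\<lambda>k. (partial_deriv j ^^ k) g (x(j := 0)) * (x j ^ k / fact k)) sums g x"
proof -
  let ?D = "\<lambda>k t. (partial_deriv j ^^ k) g (x(j := t))"
  have xj: "x j \<in> {0..1}" using x by (auto simp: cube_def)
  have sm: "smooth_on_cube d ((partial_deriv j ^^ k) g)" for k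
    using smooth_foldr[OF g, of "replicate k j"] x(2) by (auto simp: set_replicate_conv_if split: if_splits)
  have der: "(?D i has_field_derivative ?D (Suc i) t) (at t within {0..1})" if "t \<in> {0..1}" for i t
    using has_partial_derivD[OF smooth_has_partial_deriv[OF sm x(2)] x that, of i] by simp
  have err: "norm (?D 0 (x j) - (\<Sum>i\<le>n. ?D i 0 * (x j - 0) ^ i / fact i)) \<le> B * c ^ Suc n * norm (x j - 0) ^ Suc n / fact n" for n
    by (rule field_Taylor[of "{0..1}" n ?D]) (use der bnd[OF cube_upd[OF x]] xj in \<open>auto simp del: funpow.simps power_Suc\<close>)
  \<comment> \<open>The remainder bound has \<open>n!\<close> in the denominator; up to a constant
    factor it is a term of the exponential series.\<close>
  have lim: "(\<lambda>n. B * c ^ Suc n * \<bar>x j\<bar> ^ Suc n / fact n) \<longlonglongrightarrow> 0"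
  proof -
    have "(\<lambda>n. (B * c * \<bar>x j\<bar>) * ((c * \<bar>x j\<bar>) ^ n /\<^sub>R fact n)) \<longlonglongrightarrow> (B * c * \<bar>x j\<bar>) * 0"
      by (intro tendsto_mult_left summable_LIMSEQ_zero summable_exp_generic)
    then show ?thesis by (simp add: power_mult_distrib field_simps)
  qed
  have "(\<lambda>n. g x - (\<Sum>i\<le>n. ?D i 0 * (x j ^ i / fact i))) \<longlonglongrightarrow> 0"
    by (rule Lim_null_comparison[OF _ lim]) (use err in simp)
  then have "(\<lambda>n. g x - (g x - (\<Sum>i\<le>n. ?D i 0 * (x j ^ i / fact i)))) \<longlonglongrightarrow> g x - 0"
    by (intro tendsto_diff tendsto_const)
  then show ?thesis by (simp add: sums_def_le)
qed


lemma exp_has_sum: "((\<lambda>k. a ^ k / fact k) has_sum exp a) UNIV" for a :: real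
  using norm_summable_imp_has_sum[OF summable_norm_exp[of a] exp_converges[of a]]
  by (simp add: divide_inverse mult.commute)

text \<open>Induction on the number of directions. The last direction \<open>j\<close> acts first in
  \<open>foldr\<close>: \<open>g\<close> is expanded in it by the one-dimensional series, and each
  derivative \<open>(partial_deriv j ^^ k) g\<close> is expanded in the other directions at the
  point whose \<open>j\<close>-th coordinate is already 0.\<close>

lemma Taylor_has_sum:
  assumes "distinct js" "set js \<subseteq> {1..d}" and "smooth_on_cube d g" and "0 \<le> B" and c: "\<And>j. 0 \<le> c j"
    and "\<And>\<alpha> y. y \<in> cube d \<Longrightarrow> \<bar>foldr (\<lambda>j. partial_deriv j ^^ \<alpha> j) js g y\<bar> \<le> B * (\<Prod>j\<in>set js. c j ^ \<alpha> j)"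
    and "x \<in> cube d"
  shows "((\<lambda>\<alpha>. foldr (\<lambda>j. partial_deriv j ^^ \<alpha> j) js g (\<lambda>i. if i \<in> set js then 0 else x i)
      * (\<Prod>j\<in>set js. x j ^ \<alpha> j / fact (\<alpha> j))) has_sum g x) (PiE (set js) (\<lambda>_. UNIV))"
  using assms(1-4,6,7)
proof (induction js arbitrary: g B x rule: rev_induct)
  case Nil
  then show ?case using has_sum_finite[of "{\<lambda>_. undefined}" "\<lambda>_. g x"] by simp
next
  case (snoc j js)
  let ?x = "x(j := 0)"
  let ?G = "\<lambda>k. (partial_deriv j ^^ k) g"
  let ?P = "PiE (set js) (\<lambda>_. UNIV :: nat set)"
  let ?z = "\<lambda>i. if i \<in> set (js @ [j]) then 0 else x i"
  let ?F = "\<lambda>(k, \<beta>). foldr (\<lambda>j. partial_deriv j ^^ \<beta> j) js (?G k) ?z * (\<Prod>i\<in>set js. x i ^ \<beta> i / fact (\<beta> i)) * (x j ^ k / fact k)"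
  let ?h = "\<lambda>(k, \<beta>). \<beta>(j := k)"
  have j: "j \<in> {1..d}" "j \<notin> set js" and js: "distinct js" "set js \<subseteq> {1..d}" using snoc.prems by auto
  have foldr_upd: "foldr (\<lambda>j'. partial_deriv j' ^^ (\<beta>(j := k)) j') js f = foldr (\<lambda>j'. partial_deriv j' ^^ \<beta> j') js f" for \<beta> k f
    using j(2) by (intro foldr_cong) auto
  have prod_upd: "(\<Prod>i\<in>set js. u i ((\<beta>(j := k)) i)) = (\<Prod>i\<in>set js. u i (\<beta> i))" for u :: "nat \<Rightarrow> nat \<Rightarrow> real" and \<beta> k
    using j(2) by (intro prod.cong) auto
  have bnd: "\<bar>foldr (\<lambda>j. partial_deriv j ^^ \<beta> j) js (?G k) y\<bar> \<le> (B * c j ^ k) * (\<Prod>i\<in>set js. c i ^ \<beta> i)"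
    if "y \<in> cube d" for \<beta> k y
  proof -
    have "foldr (\<lambda>i. partial_deriv i ^^ (\<beta>(j := k)) i) (js @ [j]) g = foldr (\<lambda>j. partial_deriv j ^^ \<beta> j) js (?G k)"
      using foldr_upd[of \<beta> k] by simp
    moreover have "(\<Prod>i\<in>set (js @ [j]). c i ^ (\<beta>(j := k)) i) = c j ^ k * (\<Prod>i\<in>set js. c i ^ \<beta> i)"
      using j(2) prod_upd[of "\<lambda>i e. c i ^ e" \<beta> k] by simp
    ultimately show ?thesis using snoc.prems(5)[OF that, of "\<beta>(j := k)"] by (simp add: mult_ac)
  qed
  have zero: "foldr (\<lambda>j. partial_deriv j ^^ 0) js f = f" for f by (induction js) auto
  have bnd0: "\<bar>?G k y\<bar> \<le> B * c j ^ k" if "y \<in> cube d" for k y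
    using bnd[OF that, of "\<lambda>_. 0" k] zero by simp
  have x': "?x \<in> cube d" using cube_upd[OF snoc.prems(6) j(1)] by simp
  have inner: "((\<lambda>\<beta>. ?F (k, \<beta>)) has_sum ?G k ?x * (x j ^ k / fact k)) ?P" for k
  proof -
    have "((\<lambda>\<beta>. foldr (\<lambda>j. partial_deriv j ^^ \<beta> j) js (?G k) (\<lambda>i. if i \<in> set js then 0 else ?x i)
        * (\<Prod>i\<in>set js. ?x i ^ \<beta> i / fact (\<beta> i))) has_sum ?G k ?x) ?P"
    proof (rule snoc.IH[OF js _ _ bnd x'])
      show "smooth_on_cube d (?G k)"
        using smooth_foldr[OF snoc.prems(3), of "replicate k j"] j by (auto simp: set_replicate_conv_if split: if_splits)
      show "0 \<le> B * c j ^ k" using snoc.prems(4) c by simp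
    qed
    moreover have "(\<lambda>i. if i \<in> set js then 0 else ?x i) = ?z" by auto
    moreover have "(\<Prod>i\<in>set js. ?x i ^ \<beta> i / fact (\<beta> i)) = (\<Prod>i\<in>set js. x i ^ \<beta> i / fact (\<beta> i))" for \<beta> :: "nat \<Rightarrow> nat"
      using j(2) by (intro prod.cong) auto
    ultimately have "((\<lambda>\<beta>. foldr (\<lambda>j. partial_deriv j ^^ \<beta> j) js (?G k) ?z
        * (\<Prod>i\<in>set js. x i ^ \<beta> i / fact (\<beta> i))) has_sum ?G k ?x) ?P" by simp
    from has_sum_cmult_left[OF this, of "x j ^ k / fact k"] show ?thesis by simp
  qed
  have outer: "((\<lambda>k. ?G k ?x * (x j ^ k / fact k)) has_sum g x) UNIV"
  proof (rule norm_summable_imp_has_sum)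
    show "(\<lambda>k. ?G k ?x * (x j ^ k / fact k)) sums g x"
      by (rule partial_Taylor_sums[OF snoc.prems(3,6) j(1) bnd0])
    show "summable (\<lambda>k. norm (?G k ?x * (x j ^ k / fact k)))"
    proof (rule summable_comparison_test')
      show "summable (\<lambda>k. B * ((c j) ^ k /\<^sub>R fact k))" by (intro summable_mult summable_exp_generic)
      fix k :: nat
      have "\<bar>?G k ?x\<bar> * (\<bar>x j\<bar> ^ k / fact k) \<le> (B * c j ^ k) * (1 / fact k)"
        using cube_coordinate[OF snoc.prems(6) j(1)] snoc.prems(4) c
        by (intro mult_mono bnd0 x' divide_right_mono power_le_one) auto
      then show "norm (norm (?G k ?x * (x j ^ k / fact k))) \<le> B * ((c j) ^ k /\<^sub>R fact k)"
        by (simp add: abs_mult power_abs divide_inverse mult_ac)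
    qed
  qed
  \<comment> \<open>As the coordinates of the cube are at most 1 in modulus, the double series is
    dominated by \<open>B\<close> times a product of exponential series in the \<open>c i\<close>.
    Absolute summability permits reading the iterated sum as one sum.\<close>
  have summ: "?F summable_on Sigma UNIV (\<lambda>_. ?P)"
  proof (rule abs_summable_summable, rule summable_on_comparison_test)
    let ?p = "\<lambda>\<beta>. \<Prod>i\<in>set js. c i ^ \<beta> i / fact (\<beta> i)"
    have p: "(?p has_sum (\<Prod>i\<in>set js. exp (c i))) ?P"
      using c by (intro has_sum_prod_PiE exp_has_sum) auto
    show "(\<lambda>(k, \<beta>). B * (c j ^ k / fact k) * ?p \<beta>) summable_on Sigma UNIV (\<lambda>_. ?P)"
    proof (rule summable_on_SigmaI)
      show "((\<lambda>\<beta>. case (k, \<beta>) of (k, \<beta>) \<Rightarrow> B * (c j ^ k / fact k) * ?p \<beta>) has_sum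
          B * (c j ^ k / fact k) * (\<Prod>i\<in>set js. exp (c i))) ?P" for k
        using has_sum_cmult_right[OF p, of "B * (c j ^ k / fact k)"] by simp
      show "(\<lambda>k. B * (c j ^ k / fact k) * (\<Prod>i\<in>set js. exp (c i))) summable_on UNIV"
        by (intro summable_on_cmult_left summable_on_cmult_right has_sum_imp_summable[OF exp_has_sum])
    qed (use snoc.prems(4) c in \<open>auto intro!: mult_nonneg_nonneg prod_nonneg divide_nonneg_nonneg\<close>)
    fix q assume "q \<in> Sigma (UNIV :: nat set) (\<lambda>_. ?P)"
    obtain k \<beta> where q: "q = (k, \<beta>)" by force
    have z: "?z \<in> cube d" using snoc.prems(2,6) by (auto simp: cube_def PiE_iff extensional_def)
    have xi: "\<bar>x i\<bar> \<le> 1" if "i \<in> {1..d}" for i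
      using cube_coordinate[OF snoc.prems(6) that] by auto
    have "\<bar>foldr (\<lambda>j. partial_deriv j ^^ \<beta> j) js (?G k) ?z\<bar> * (\<Prod>i\<in>set js. \<bar>x i\<bar> ^ \<beta> i / fact (\<beta> i)) * (\<bar>x j\<bar> ^ k / fact k)
        \<le> ((B * c j ^ k) * (\<Prod>i\<in>set js. c i ^ \<beta> i)) * (\<Prod>i\<in>set js. 1 / fact (\<beta> i)) * (1 / fact k)"
    proof (intro mult_mono bnd z prod_mono conjI divide_right_mono power_le_one mult_nonneg_nonneg prod_nonneg divide_nonneg_nonneg)
      show "\<bar>x i\<bar> \<le> 1" if "i \<in> set js" for i using xi js(2) that by blast
      show "\<bar>x j\<bar> \<le> 1" using xi j by blast
    qed (use snoc.prems(4) c in auto)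
    then show "norm (?F q) \<le> (case q of (k, \<beta>) \<Rightarrow> B * (c j ^ k / fact k) * ?p \<beta>)"
      by (simp add: q abs_mult abs_prod power_abs prod_dividef mult_ac)
  qed auto
  have "(?F has_sum g x) (UNIV \<times> ?P)"
    by (rule has_sum_SigmaI[OF inner outer summ])
  \<comment> \<open>The pair of \<open>k\<close> and \<open>\<beta>\<close> encodes the multi-index
    \<open>\<beta>(j := k)\<close> of the longer list.\<close>
  moreover have "?F = (\<lambda>\<alpha>. foldr (\<lambda>j. partial_deriv j ^^ \<alpha> j) (js @ [j]) g ?z * (\<Prod>i\<in>set (js @ [j]). x i ^ \<alpha> i / fact (\<alpha> i))) \<circ> ?h"
  proof (rule ext)
    fix q :: "nat \<times> (nat \<Rightarrow> nat)"
    obtain k \<beta> where q: "q = (k, \<beta>)" by force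
    show "?F q = ((\<lambda>\<alpha>. foldr (\<lambda>j. partial_deriv j ^^ \<alpha> j) (js @ [j]) g ?z * (\<Prod>i\<in>set (js @ [j]). x i ^ \<alpha> i / fact (\<alpha> i))) \<circ> ?h) q"
      using j(2) prod_upd[of "\<lambda>i e. x i ^ e / fact e" \<beta> k] foldr_upd[of \<beta> k] by (simp add: q mult_ac)
  qed
  ultimately have "((\<lambda>\<alpha>. foldr (\<lambda>j. partial_deriv j ^^ \<alpha> j) (js @ [j]) g ?z * (\<Prod>i\<in>set (js @ [j]). x i ^ \<alpha> i / fact (\<alpha> i))) has_sum g x) (?h ` (UNIV \<times> ?P))"
    using j(2) by (subst has_sum_reindex) (auto intro!: inj_combinator[of j "set js" "\<lambda>_. UNIV"])
  moreover have "?h ` (UNIV \<times> ?P) = PiE (set (js @ [j])) (\<lambda>_. UNIV)"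
    using PiE_insert_eq[of j "set js" "\<lambda>_. UNIV :: nat set"] by simp
  ultimately show ?case by simp
qed

section \<open>Truncated Taylor series\<close>

text \<open>The contribution of one coordinate to \<open>E\<close>. The term for
  \<open>k = 0\<close> is 1; every other term contains the factor \<open>g powr \<kappa>\<close>,
  and what remains is dominated by a convergent series depending only on \<open>C\<close> and
  \<open>\<kappa>\<close>. Then \<open>1 + x \<le> exp x\<close>.\<close>

lemma factorial_powr_sum_bound:
  fixes C \<kappa> :: real
  assumes C: "C > 0" and \<kappa>: "\<kappa> > 0"
  shows "\<exists>K\<ge>0. \<forall>g. 0 < g \<longrightarrow> g \<le> C \<longrightarrow>
    (\<exists>s. ((\<lambda>k. (g ^ k / fact k) powr \<kappa>) has_sum s) UNIV \<and> s \<le> exp (K * g powr \<kappa>))"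
proof -
  define b where "b k = (C ^ k / fact (Suc k)) powr \<kappa>" for k :: nat
  \<comment> \<open>With \<open>r powr \<kappa> = 2\<close>, the estimate
    \<open>C ^ k / fact k \<le> exp (C * r) / r ^ k\<close> becomes geometric with ratio 1/2 after
    taking the power \<open>\<kappa>\<close>.\<close>
  define r where "r = 2 powr (1 / \<kappa>)"
  have r: "r > 0" "r powr \<kappa> = 2" using \<kappa> by (auto simp: r_def powr_powr)
  have "summable b"
  proof (rule summable_comparison_test')
    show "summable (\<lambda>k. exp (C * r) powr \<kappa> * (1/2) ^ k)" by (intro summable_mult summable_geometric) simp
    fix k :: nat
    have "((C * r) ^ k / fact k) \<le> exp (C * r)"
      using has_sum_mono2[OF has_sum_finite[of "{k}"] exp_has_sum[of "C * r"]] C r by simp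
    then have "C ^ k / fact k \<le> exp (C * r) / r ^ k"
      using r by (simp add: power_mult_distrib field_simps)
    moreover have "C ^ k / fact (Suc k) \<le> C ^ k / fact k"
      using C by (intro divide_left_mono fact_mono) auto
    ultimately have "b k \<le> (exp (C * r) / r ^ k) powr \<kappa>"
      unfolding b_def using C \<kappa> by (intro powr_mono2) auto
    also have "\<dots> = exp (C * r) powr \<kappa> / (r ^ k) powr \<kappa>"
      by (rule powr_divide)
    also have "(r ^ k) powr \<kappa> = (r powr \<kappa>) ^ k" using powr_realpow[OF r(1), of k] r(1) by (simp add: powr_power powr_powr[symmetric])
    finally show "norm (b k) \<le> exp (C * r) powr \<kappa> * (1/2) ^ k"
      using r by (simp add: b_def power_divide)
  qed
  define K where "K = suminf b"
  have K: "K \<ge> 0" unfolding K_def using \<open>summable b\<close> by (rule suminf_nonneg) (simp add: b_def)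
  have "\<exists>s. ((\<lambda>k. (g ^ k / fact k) powr \<kappa>) has_sum s) UNIV \<and> s \<le> exp (K * g powr \<kappa>)" if g: "0 < g" "g \<le> C" for g
  proof -
    let ?t = "\<lambda>k. (g ^ k / fact k) powr \<kappa>"
    have t: "?t (Suc k) \<le> g powr \<kappa> * b k" for k
    proof -
      have "?t (Suc k) = (g * (g ^ k / fact (Suc k))) powr \<kappa>" by simp
      also have "\<dots> = g powr \<kappa> * (g ^ k / fact (Suc k)) powr \<kappa>"
        by (rule powr_mult)
      also have "(g ^ k / fact (Suc k)) powr \<kappa> \<le> b k"
        unfolding b_def using g \<kappa> by (intro powr_mono2 divide_right_mono power_mono) auto
      finally show ?thesis by (simp add: mult_left_mono)
    qed
    have sg: "summable (\<lambda>k. g powr \<kappa> * b k)" by (intro summable_mult \<open>summable b\<close>)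
    have S: "summable (\<lambda>k. ?t (Suc k))"
      by (rule summable_comparison_test'[OF sg]) (use t in simp)
    then have "summable ?t" by (subst (asm) summable_Suc_iff)
    then have "(?t has_sum suminf ?t) UNIV"
      by (intro sums_nonneg_imp_has_sum summable_sums) auto
    moreover have "suminf ?t = 1 + (\<Sum>k. ?t (Suc k))"
      using suminf_split_head[OF \<open>summable ?t\<close>] by simp
    moreover have "(\<Sum>k. ?t (Suc k)) \<le> (\<Sum>k. g powr \<kappa> * b k)" by (intro suminf_le t S sg)
    moreover have "(\<Sum>k. g powr \<kappa> * b k) = K * g powr \<kappa>"
      unfolding K_def by (subst suminf_mult[OF \<open>summable b\<close>]) simp
    ultimately show ?thesis
      using exp_ge_add_one_self[of "K * g powr \<kappa>"] by (intro exI[of _ "suminf ?t"] conjI) linarith+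
  qed
  with K show ?thesis by blast
qed

section \<open>Taylor coefficients at the origin as admissible information\<close>

definition origin :: "nat \<Rightarrow> point" where
  "origin d = (\<lambda>i. if i \<in> {1..d} then 0 else undefined)"

lemma origin_in_cube: "origin d \<in> cube d"
  by (auto simp: origin_def cube_def)

definition taylor_monomial :: "nat \<Rightarrow> (nat \<Rightarrow> nat) \<Rightarrow> rfun" where
  "taylor_monomial d \<alpha> x = (\<Prod>i\<in>{1..d}. x i ^ \<alpha> i / fact (\<alpha> i))"

lemma continuous_on_taylor_monomial: "continuous_on S (taylor_monomial d \<alpha>)"
  unfolding taylor_monomial_def
  by (intro continuous_intros continuous_on_product_then_coordinatewise[OF continuous_on_id]) auto

lemma taylor_monomial_bound:
  assumes "x \<in> cube d"
  shows "\<bar>taylor_monomial d \<alpha> x\<bar> \<le> (\<Prod>i\<in>{1..d}. 1 / fact (\<alpha> i))"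
  unfolding taylor_monomial_def abs_prod
  using cube_coordinate[OF assms]
  by (intro prod_mono) (auto simp: abs_mult power_abs intro!: divide_right_mono power_le_one)

lemma sum_taylor_monomial_Linf: "(\<lambda>x. \<Sum>j=1..n. y j * taylor_monomial d (b j) x) \<in> Linf d"
proof (rule continuous_bounded_Linf)
  show "continuous_on (cube d) (\<lambda>x. \<Sum>j=1..n. y j * taylor_monomial d (b j) x)"
    by (intro continuous_intros continuous_on_taylor_monomial)
  fix x assume x: "x \<in> cube d"
  show "\<bar>\<Sum>j=1..n. y j * taylor_monomial d (b j) x\<bar> \<le> (\<Sum>j=1..n. \<bar>y j\<bar> * (\<Prod>i\<in>{1..d}. 1 / fact (b j i)))"
    by (intro order_trans[OF sum_abs] sum_mono) (simp add: abs_mult mult_left_mono taylor_monomial_bound[OF x, simplified])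
qed

lemma F_space_smooth: "f \<in> F_space \<gamma> d \<Longrightarrow> smooth_on_cube d f"
  by (simp add: F_space_def)

locale positive_weights =
  fixes \<gamma> :: "nat \<Rightarrow> nat \<Rightarrow> real" and d :: nat
  assumes pos: "\<And>j. j \<in> {1..d} \<Longrightarrow> 0 < \<gamma> d j"
begin

lemma weight_pos: "weight \<gamma> d \<alpha> > 0"
  unfolding weight_def using pos by (intro prod_pos) auto

lemma mixed_deriv_bound:
  assumes f: "smooth_on_cube d f" and B: "F_norm \<gamma> d f \<le> ereal B" and x: "x \<in> cube d"
  shows "\<bar>mixed_deriv d \<alpha> f x\<bar> \<le> weight \<gamma> d \<alpha> * B"
proof -
  \<comment> \<open>The norm ranges over extensional multi-indices; restricting
    \<open>\<alpha>\<close> changes neither its derivative nor its weight.\<close>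
  let ?\<alpha> = "restrict \<alpha> {1..d}"
  have "mixed_deriv d ?\<alpha> f = mixed_deriv d \<alpha> f" unfolding mixed_deriv_def by (intro foldr_cong) auto
  moreover have "weight \<gamma> d ?\<alpha> = weight \<gamma> d \<alpha>" unfolding weight_def by (intro prod.cong) auto
  moreover have "?\<alpha> \<in> multi_indices d" by (auto simp: multi_indices_def)
  ultimately show ?thesis using F_norm_ge[OF f weight_pos _ B x, of ?\<alpha>] by simp
qed

lemma Taylor_on_cube:
  assumes f: "smooth_on_cube d f" and B: "F_norm \<gamma> d f \<le> ereal B" and x: "x \<in> cube d"
  shows "((\<lambda>\<alpha>. mixed_deriv d \<alpha> f (origin d) * taylor_monomial d \<alpha> x) has_sum f x) (multi_indices d)"
proof -
  let ?js = "[1..<Suc d]"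
  have js: "set ?js = {1..d}" by auto
  \<comment> \<open>\<open>Taylor_has_sum\<close> requires nonnegative factors at all indices, but
    the weights are known to be positive only on \<open>{1..d}\<close>; hence the absolute
    values.\<close>
  have w: "weight \<gamma> d \<alpha> = (\<Prod>j\<in>set ?js. \<bar>\<gamma> d j\<bar> ^ \<alpha> j)" for \<alpha>
    unfolding weight_def js using pos by (intro prod.cong) (auto simp: less_imp_le)
  have "0 \<le> B"
  proof -
    have "0 \<le> weight \<gamma> d (\<lambda>_. 0) * B" using mixed_deriv_bound[OF f B x, of "\<lambda>_. 0"] by linarith
    then show ?thesis using weight_pos[of "\<lambda>_. 0"] by (simp add: zero_le_mult_iff)
  qed
  have bnd: "\<bar>foldr (\<lambda>j. partial_deriv j ^^ \<alpha> j) ?js f y\<bar> \<le> B * (\<Prod>j\<in>set ?js. \<bar>\<gamma> d j\<bar> ^ \<alpha> j)"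
    if "y \<in> cube d" for \<alpha> y
    using mixed_deriv_bound[OF f B that, of \<alpha>] unfolding w mixed_deriv_def by (simp only: mult.commute)
  have zero: "(\<lambda>i. if i \<in> set ?js then 0 else x i) = origin d"
    unfolding js origin_def using PiE_arb[OF x[unfolded cube_def]] by (intro ext) (metis (full_types))
  have "((\<lambda>\<alpha>. mixed_deriv d \<alpha> f (\<lambda>i. if i \<in> set ?js then 0 else x i) * (\<Prod>j\<in>set ?js. x j ^ \<alpha> j / fact (\<alpha> j)))
      has_sum f x) (PiE (set ?js) (\<lambda>_. UNIV))"
    unfolding mixed_deriv_def
    by (rule Taylor_has_sum[of ?js d f B "\<lambda>j. \<bar>\<gamma> d j\<bar>" x, OF distinct_upt _ f \<open>0 \<le> B\<close> abs_ge_zero bnd x])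
       (simp_all only: js order_refl)
  then show ?thesis unfolding zero unfolding js taylor_monomial_def multi_indices_def .
qed

text \<open>Continuity comes from \<open>mixed_deriv_bound\<close> applied to the difference of two
  functions; the factor 2 in the choice of \<open>\<delta>\<close> makes the final inequality
  strict.\<close>

lemma continuous_linear_functional_mixed_deriv:
  assumes x: "x \<in> cube d"
  shows "continuous_linear_functional \<gamma> d (\<lambda>f. mixed_deriv d \<alpha> f x)"
  unfolding continuous_linear_functional_def linear_functional_def continuous_functional_def
proof (intro conjI ballI allI impI)
  fix f g assume "f \<in> F_space \<gamma> d" "g \<in> F_space \<gamma> d"
  then show "mixed_deriv d \<alpha> (\<lambda>x. f x + g x) x = mixed_deriv d \<alpha> f x + mixed_deriv d \<alpha> g x"
    using mixed_deriv_lincomb[of d f g x \<alpha> 1 1] x by (simp add: F_space_smooth)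
next
  fix c f assume "f \<in> F_space \<gamma> d"
  then show "mixed_deriv d \<alpha> (\<lambda>x. c * f x) x = c * mixed_deriv d \<alpha> f x"
    using mixed_deriv_lincomb[of d f f x \<alpha> c 0] x by (simp add: F_space_smooth)
next
  fix f and \<epsilon> :: real assume f: "f \<in> F_space \<gamma> d" and \<epsilon>: "\<epsilon> > 0"
  let ?\<delta> = "\<epsilon> / (2 * weight \<gamma> d \<alpha>)"
  have "\<bar>mixed_deriv d \<alpha> g x - mixed_deriv d \<alpha> f x\<bar> < \<epsilon>"
    if g: "g \<in> F_space \<gamma> d" and lt: "F_norm \<gamma> d (\<lambda>x. g x - f x) < ereal ?\<delta>" for g
  proof -
    have "smooth_on_cube d (\<lambda>x. g x - f x)"
      using smooth_lincomb[of d g f 1 "-1"] f g by (simp add: F_space_smooth)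
    then have "\<bar>mixed_deriv d \<alpha> (\<lambda>x. g x - f x) x\<bar> \<le> weight \<gamma> d \<alpha> * ?\<delta>"
      using lt by (intro mixed_deriv_bound x) auto
    also have "\<dots> < \<epsilon>" using weight_pos[of \<alpha>] \<epsilon> by simp
    finally show ?thesis
      using mixed_deriv_lincomb[of d g f x \<alpha> 1 "-1"] x f g by (simp add: F_space_smooth)
  qed
  then show "\<exists>\<delta>>0. \<forall>g\<in>F_space \<gamma> d. F_norm \<gamma> d (\<lambda>x. g x - f x) < ereal \<delta> \<longrightarrow> \<bar>mixed_deriv d \<alpha> g x - mixed_deriv d \<alpha> f x\<bar> < \<epsilon>"
    using weight_pos[of \<alpha>] \<epsilon> by (intro exI[of _ ?\<delta>]) auto
qed

text \<open>The number \<open>a\<^sub>\<alpha>\<close> of the introduction: the weight of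
  \<open>\<alpha>\<close> times the maximum of its Taylor monomial on the cube.\<close>

definition coeff_bound :: "(nat \<Rightarrow> nat) \<Rightarrow> real" where
  "coeff_bound \<alpha> = (\<Prod>i\<in>{1..d}. \<gamma> d i ^ \<alpha> i / fact (\<alpha> i))"

lemma coeff_bound_pos: "coeff_bound \<alpha> > 0"
  unfolding coeff_bound_def using pos by (intro prod_pos) auto

lemma taylor_term_bound:
  assumes f: "smooth_on_cube d f" and B: "F_norm \<gamma> d f \<le> 1" and x: "x \<in> cube d"
  shows "\<bar>mixed_deriv d \<alpha> f (origin d) * taylor_monomial d \<alpha> x\<bar> \<le> coeff_bound \<alpha>"
proof -
  have "\<bar>mixed_deriv d \<alpha> f (origin d)\<bar> * \<bar>taylor_monomial d \<alpha> x\<bar> \<le> weight \<gamma> d \<alpha> * (\<Prod>i\<in>{1..d}. 1 / fact (\<alpha> i))"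
    using mixed_deriv_bound[OF f _ origin_in_cube, of 1 \<alpha>] B taylor_monomial_bound[OF x, of \<alpha>] weight_pos[of \<alpha>]
    by (intro mult_mono) (auto simp: one_ereal_def)
  also have "\<dots> = coeff_bound \<alpha>"
    unfolding weight_def coeff_bound_def prod.distrib[symmetric] by simp
  finally show ?thesis by (simp add: abs_mult)
qed

definition taylor_algorithm :: "nat \<Rightarrow> (nat \<Rightarrow> nat \<Rightarrow> nat) \<Rightarrow> algorithm" where
  "taylor_algorithm n b f = (\<lambda>x. \<Sum>j=1..n. mixed_deriv d (b j) f (origin d) * taylor_monomial d (b j) x)"

lemma taylor_algorithm_linear: "taylor_algorithm n b \<in> linear_algorithms \<gamma> d n"
proof -
  have "taylor_monomial d (b j) \<in> Linf d" for j
    by (rule continuous_bounded_Linf[OF continuous_on_taylor_monomial taylor_monomial_bound])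
  then show ?thesis
    unfolding linear_algorithms_def mem_Collect_eq
    by (intro exI[of _ n] conjI order_refl exI[of _ "\<lambda>j f. mixed_deriv d (b j) f (origin d)"]
        exI[of _ "\<lambda>j. taylor_monomial d (b j)"] ballI continuous_linear_functional_mixed_deriv origin_in_cube)
      (simp_all add: taylor_algorithm_def)
qed

lemma taylor_algorithm_general: "taylor_algorithm n b \<in> general_algorithms \<gamma> d n"
proof -
  define L where "L j f = mixed_deriv d (b j) f (origin d)" for j f
  \<comment> \<open>Functionals are numbered from 1, list positions from 0.\<close>
  define \<phi> where "\<phi> y = (\<lambda>x. \<Sum>j=1..n. y ! (j - 1) * taylor_monomial d (b j) x)" for y
  have nth: "nonadaptive_info L n f ! (j - 1) = L j f" if "j \<in> {1..n}" for f j
  proof -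
    have "j - 1 < length [1..<Suc n]" "[1..<Suc n] ! (j - 1) = j" using that by (auto simp del: upt_Suc)
    then show ?thesis unfolding nonadaptive_info_def by (simp del: upt_Suc)
  qed
  have "nonadaptive_info L n \<in> nonadaptive_continuous_information \<gamma> d n"
    unfolding nonadaptive_continuous_information_def
    using continuous_linear_functional_mixed_deriv[OF origin_in_cube]
    by (intro CollectI exI[of _ L]) (simp add: L_def[abs_def] continuous_linear_functional_def)
  moreover have "\<phi> y \<in> Linf d" for y unfolding \<phi>_def by (rule sum_taylor_monomial_Linf)
  moreover have "taylor_algorithm n b f = \<phi> (nonadaptive_info L n f)" for f
    unfolding taylor_algorithm_def \<phi>_def using nth by (intro ext sum.cong) (auto simp: L_def)
  ultimately show ?thesis
    unfolding general_algorithms_def mem_Collect_eq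
    by (intro exI[of _ n] conjI order_refl exI[of _ "nonadaptive_info L n"] exI[of _ \<phi>]) simp_all
qed

text \<open>The sum of the \<open>a\<^sub>\<alpha>\<close> to the power \<open>\<kappa>\<close>
  factors over the coordinates and is at most \<open>E\<close>. It controls both the number of terms
  above the threshold \<open>\<delta>\<close> and the sum of the remaining ones.\<close>

lemma info_complexity_le:
  assumes alg: "\<A> \<in> {linear_algorithms \<gamma>, general_algorithms \<gamma>}"
    and C: "\<And>j. j \<in> {1..d} \<Longrightarrow> \<gamma> d j \<le> C" and \<kappa>: "0 < \<kappa>" "\<kappa> < 1"
    and K: "\<And>g. 0 < g \<Longrightarrow> g \<le> C \<Longrightarrow>
      (\<exists>s. ((\<lambda>k. (g ^ k / fact k) powr \<kappa>) has_sum s) UNIV \<and> s \<le> exp (K * g powr \<kappa>))"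
    and \<epsilon>: "0 < \<epsilon>"
  shows "\<exists>n. info_complexity \<gamma> \<A> \<epsilon> d \<le> enat n \<and>
    real n \<le> exp (K / (1 - \<kappa>) * (\<Sum>j=1..d. \<gamma> d j powr \<kappa>)) * \<epsilon> powr (- (\<kappa> / (1 - \<kappa>)))"
proof -
  define E where "E = exp (K * (\<Sum>j=1..d. \<gamma> d j powr \<kappa>))"
  have "\<forall>j\<in>{1..d}. \<exists>s. ((\<lambda>k. (\<gamma> d j ^ k / fact k) powr \<kappa>) has_sum s) UNIV \<and> s \<le> exp (K * \<gamma> d j powr \<kappa>)"
    using K C pos by blast
  then obtain s where s: "\<And>j. j \<in> {1..d} \<Longrightarrow> ((\<lambda>k. (\<gamma> d j ^ k / fact k) powr \<kappa>) has_sum s j) UNIV"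
    and sle: "\<And>j. j \<in> {1..d} \<Longrightarrow> s j \<le> exp (K * \<gamma> d j powr \<kappa>)" by metis
  have s0: "0 \<le> s j" if "j \<in> {1..d}" for j
    using s[OF that] by (rule has_sum_nonneg) auto
  have powr_eq: "coeff_bound \<alpha> powr \<kappa> = (\<Prod>i\<in>{1..d}. (\<gamma> d i ^ \<alpha> i / fact (\<alpha> i)) powr \<kappa>)" for \<alpha>
    unfolding coeff_bound_def by (rule prod_powr_distrib)
  have sum: "((\<lambda>\<alpha>. coeff_bound \<alpha> powr \<kappa>) has_sum (\<Prod>j\<in>{1..d}. s j)) (multi_indices d)"
    unfolding powr_eq multi_indices_def by (rule has_sum_prod_PiE) (use s in auto)
  have "(\<Prod>j\<in>{1..d}. s j) \<le> (\<Prod>j\<in>{1..d}. exp (K * \<gamma> d j powr \<kappa>))"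
    using s0 sle by (intro prod_mono) auto
  also have "\<dots> = E" unfolding E_def by (simp add: exp_sum sum_distrib_left)
  finally have sE: "(\<Prod>j\<in>{1..d}. s j) \<le> E" .
  have E: "E > 0" by (simp add: E_def)
  \<comment> \<open>The solution of \<open>\<delta> powr (1 - \<kappa>) * E = \<epsilon>\<close>, so
    that the truncation error is exactly affordable.\<close>
  define \<delta> where "\<delta> = (\<epsilon> / E) powr (1 / (1 - \<kappa>))"
  have \<delta>: "\<delta> > 0" using \<epsilon> E by (simp add: \<delta>_def)
  define S where "S = {\<alpha> \<in> multi_indices d. coeff_bound \<alpha> > \<delta>}"
  \<comment> \<open>Markov's inequality for the sum of the \<open>\<kappa>\<close>-th powers\<close>
  have card_bound: "real (card T) * \<delta> powr \<kappa> \<le> E" if T: "finite T" "T \<subseteq> S" for T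
  proof -
    have "real (card T) * \<delta> powr \<kappa> = (\<Sum>\<alpha>\<in>T. \<delta> powr \<kappa>)" by simp
    also have "\<dots> \<le> (\<Sum>\<alpha>\<in>T. coeff_bound \<alpha> powr \<kappa>)"
      using T \<delta> \<kappa> by (intro sum_mono powr_mono2) (auto simp: S_def)
    also have "\<dots> \<le> (\<Prod>j\<in>{1..d}. s j)"
      using T by (intro finite_sum_le_has_sum[OF sum]) (auto simp: S_def)
    finally show ?thesis using sE by simp
  qed
  have fin: "finite S"
  proof (rule ccontr)
    assume "infinite S"
    obtain k :: nat where k: "real k > E / \<delta> powr \<kappa>" using reals_Archimedean2 by blast
    obtain T where T: "T \<subseteq> S" "finite T" "card T = k"
      using infinite_arbitrarily_large[OF \<open>infinite S\<close>] by metis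
    then show False using card_bound[OF T(2,1)] k \<delta> by (simp add: field_simps)
  qed
  define n where "n = card S"
  obtain b where b: "bij_betw b {1..n} S"
    using ex_bij_betw_nat_finite_1[OF fin] n_def by blast
  have err: "worst_case_error \<gamma> d (taylor_algorithm n b) \<le> ereal \<epsilon>"
    unfolding worst_case_error_def
  proof (rule SUP_least, clarify)
    fix f assume fF: "f \<in> F_space \<gamma> d" and f1: "F_norm \<gamma> d f \<le> 1"
    have f: "smooth_on_cube d f" using fF by (rule F_space_smooth)
    show "Linf_norm d (\<lambda>x. f x - taylor_algorithm n b f x) \<le> ereal \<epsilon>"
    proof (rule Linf_norm_le)
      show "continuous_on (cube d) (\<lambda>x. f x - taylor_algorithm n b f x)"
        unfolding taylor_algorithm_def
        by (intro continuous_intros continuous_on_taylor_monomial smooth_continuous f)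
      fix x assume x: "x \<in> cube d"
      let ?t = "\<lambda>\<alpha>. mixed_deriv d \<alpha> f (origin d) * taylor_monomial d \<alpha> x"
      have "taylor_algorithm n b f x = (\<Sum>\<alpha>\<in>S. ?t \<alpha>)"
        unfolding taylor_algorithm_def by (rule sum.reindex_bij_betw[OF b])
      then have A: "(?t has_sum taylor_algorithm n b f x) S" using has_sum_finite[OF fin] by metis
      have "(?t has_sum f x) (multi_indices d)"
        using f1 by (intro Taylor_on_cube[OF f _ x, of 1]) (simp add: one_ereal_def)
      from has_sum_Diff[OF this A] have R: "(?t has_sum f x - taylor_algorithm n b f x) (multi_indices d - S)"
        by (auto simp: S_def)
      have "(\<lambda>\<alpha>. coeff_bound \<alpha> powr \<kappa>) summable_on multi_indices d - S"
        using has_sum_imp_summable[OF sum] by (rule summable_on_subset_banach) auto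
      then obtain u where u: "((\<lambda>\<alpha>. coeff_bound \<alpha> powr \<kappa>) has_sum u) (multi_indices d - S)"
        by (auto simp: summable_on_def)
      have uE: "u \<le> E"
        using has_sum_mono2[OF u sum] sE by force
      have dom: "((\<lambda>\<alpha>. \<delta> powr (1 - \<kappa>) * coeff_bound \<alpha> powr \<kappa>) has_sum \<delta> powr (1 - \<kappa>) * u) (multi_indices d - S)"
        by (rule has_sum_cmult_right[OF u])
      \<comment> \<open>Off \<open>S\<close> a factor
        \<open>coeff_bound \<alpha> powr (1 - \<kappa>)\<close> is at most
        \<open>\<delta> powr (1 - \<kappa>)\<close>; the other factor remains summable.\<close>
      have le: "\<bar>?t \<alpha>\<bar> \<le> \<delta> powr (1 - \<kappa>) * coeff_bound \<alpha> powr \<kappa>" if \<alpha>: "\<alpha> \<in> multi_indices d - S" for \<alpha>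
      proof -
        have "\<bar>?t \<alpha>\<bar> \<le> coeff_bound \<alpha>" by (rule taylor_term_bound[OF f f1 x])
        also have "\<dots> = coeff_bound \<alpha> powr (1 - \<kappa>) * coeff_bound \<alpha> powr \<kappa>"
          using coeff_bound_pos[of \<alpha>] by (simp flip: powr_add)
        also have "\<dots> \<le> \<delta> powr (1 - \<kappa>) * coeff_bound \<alpha> powr \<kappa>"
          using \<alpha> coeff_bound_pos[of \<alpha>] \<kappa> by (intro mult_right_mono powr_mono2) (auto simp: S_def)
        finally show ?thesis .
      qed
      have "f x - taylor_algorithm n b f x \<le> \<delta> powr (1 - \<kappa>) * u"
        by (rule has_sum_mono[OF R dom]) (use le in force)
      moreover have "- (f x - taylor_algorithm n b f x) \<le> \<delta> powr (1 - \<kappa>) * u"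
        by (rule has_sum_mono[OF has_sum_uminusI[OF R] dom]) (use le in force)
      ultimately have "\<bar>f x - taylor_algorithm n b f x\<bar> \<le> \<delta> powr (1 - \<kappa>) * u" by linarith
      also have "\<dots> \<le> \<delta> powr (1 - \<kappa>) * E" using uE by (intro mult_left_mono) auto
      also have "\<dots> = \<epsilon>" using \<kappa> \<epsilon> E by (simp add: \<delta>_def powr_powr)
      finally show "\<bar>f x - taylor_algorithm n b f x\<bar> \<le> \<epsilon>" .
    qed
  qed
  have "taylor_algorithm n b \<in> \<A> d n"
    using alg taylor_algorithm_linear taylor_algorithm_general by auto
  then have "minimal_error \<gamma> \<A> n d \<le> ereal \<epsilon>"
    unfolding minimal_error_def using err by (intro INF_lower2[of "taylor_algorithm n b"])
  then have "info_complexity \<gamma> \<A> \<epsilon> d \<le> enat n"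
    unfolding info_complexity_def by (intro Inf_lower) auto
  moreover have "real n \<le> exp (K / (1 - \<kappa>) * (\<Sum>j=1..d. \<gamma> d j powr \<kappa>)) * \<epsilon> powr (- (\<kappa> / (1 - \<kappa>)))"
  proof -
    have "real n \<le> E * \<delta> powr (- \<kappa>)"
      using card_bound[OF fin order_refl] \<delta> by (simp add: n_def powr_minus field_simps)
    also have "\<delta> powr (- \<kappa>) = (\<epsilon> / E) powr (- (\<kappa> / (1 - \<kappa>)))"
      by (simp add: \<delta>_def powr_powr)
    also have "\<dots> = \<epsilon> powr (- (\<kappa> / (1 - \<kappa>))) * E powr (\<kappa> / (1 - \<kappa>))"
      using \<epsilon> E by (simp add: powr_divide powr_minus field_simps)
    also have "E * (\<epsilon> powr (- (\<kappa> / (1 - \<kappa>))) * E powr (\<kappa> / (1 - \<kappa>)))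
        = (E powr 1 * E powr (\<kappa> / (1 - \<kappa>))) * \<epsilon> powr (- (\<kappa> / (1 - \<kappa>)))" using E by simp
    also have "E powr 1 * E powr (\<kappa> / (1 - \<kappa>)) = E powr (1 / (1 - \<kappa>))"
      unfolding powr_add[symmetric] using \<kappa> by (simp add: field_simps)
    also have "\<dots> = exp (K / (1 - \<kappa>) * (\<Sum>j=1..d. \<gamma> d j powr \<kappa>))"
      by (simp add: E_def powr_def)
    finally show ?thesis .
  qed
  ultimately show ?thesis by blast
qed

end

section \<open>Lower bound from multilinear functions of block means\<close>

text \<open>Multilinear interpolation of the value \<open>c T\<close> at the vertex of \<open>[0,1]\<^sup>s\<close> whose support is \<open>T\<close>.\<close>

fun interp :: "nat \<Rightarrow> (nat set \<Rightarrow> real) \<Rightarrow> (nat \<Rightarrow> real) \<Rightarrow> real" where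
  "interp 0 c u = c {}"
| "interp (Suc s) c u = (1 - u s) * interp s c u + u s * interp s (\<lambda>T. c (insert s T)) u"

lemma interp_cong:
  assumes "\<And>T. T \<subseteq> {..<s} \<Longrightarrow> c T = c' T" and "\<And>l. l < s \<Longrightarrow> u l = u' l"
  shows "interp s c u = interp s c' u'"
  using assms
proof (induction s arbitrary: c c')
  case (Suc s)
  have "interp s c u = interp s c' u'" using Suc.prems(2) by (intro Suc.IH Suc.prems(1)) auto
  moreover have "interp s (\<lambda>T. c (insert s T)) u = interp s (\<lambda>T. c' (insert s T)) u'"
    using Suc.prems(2) by (intro Suc.IH Suc.prems(1)) auto
  ultimately show ?case using Suc.prems(2)[of s] by simp
qed simp

lemma interp_bound:
  assumes "\<And>T. T \<subseteq> {..<s} \<Longrightarrow> \<bar>c T\<bar> \<le> B" and "\<And>l. l < s \<Longrightarrow> u l \<in> {0..1}"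
  shows "\<bar>interp s c u\<bar> \<le> B"
  using assms
proof (induction s arbitrary: c)
  case (Suc s)
  have 1: "\<bar>interp s c u\<bar> \<le> B" using Suc.prems(2) by (intro Suc.IH Suc.prems(1)) auto
  have 2: "\<bar>interp s (\<lambda>T. c (insert s T)) u\<bar> \<le> B" using Suc.prems(2) by (intro Suc.IH Suc.prems(1)) auto
  have u: "0 \<le> u s" "u s \<le> 1" using Suc.prems(2)[of s] by auto
  have "\<bar>interp (Suc s) c u\<bar> \<le> (1 - u s) * \<bar>interp s c u\<bar> + u s * \<bar>interp s (\<lambda>T. c (insert s T)) u\<bar>"
    using u by (auto simp: abs_mult intro: order_trans[OF abs_triangle_ineq])
  also have "\<dots> \<le> (1 - u s) * B + u s * B" using 1 2 u by (intro add_mono mult_left_mono) auto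
  finally show ?case by (simp add: algebra_simps)
qed auto

lemma interp_vertex:
  "(\<And>l. l < s \<Longrightarrow> u l = of_bool (l \<in> T)) \<Longrightarrow> interp s c u = c (T \<inter> {..<s})"
proof (induction s arbitrary: c)
  case (Suc s)
  then have "interp s c u = c (T \<inter> {..<s})" for c by auto
  then show ?case using Suc.prems[of s] by (cases "s \<in> T") (auto simp: lessThan_Suc)
qed simp

lemma interp_lincomb:
  "interp s (\<lambda>T. a * c T + b * c' T) u = a * interp s c u + b * interp s c' u"
  by (induction s arbitrary: c c') (auto simp: algebra_simps)

lemma continuous_on_interp:
  "(\<And>l. l < s \<Longrightarrow> continuous_on A (\<lambda>x. u x l)) \<Longrightarrow> continuous_on A (\<lambda>x. interp s c (u x))"
  by (induction s arbitrary: c) (auto intro!: continuous_intros)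

text \<open>Vertex values of the partial derivative in variable \<open>l\<close>. They do not depend
  on whether \<open>l\<close> lies in \<open>T\<close>, so their interpolation is constant in that
  variable.\<close>

definition coeff_diff :: "nat \<Rightarrow> (nat set \<Rightarrow> real) \<Rightarrow> nat set \<Rightarrow> real" where
  "coeff_diff l c T = c (insert l T) - c (T - {l})"

text \<open>An affine function of one variable has the difference of its end values as slope. If
  \<open>l\<close> is the outermost variable this is read off the recursion; otherwise
  differentiation passes to the two inner interpolations. \<open>D\<close> is the chain rule
  factor.\<close>

lemma interp_has_derivative:
  assumes "l < s" and p: "(p has_real_derivative D) (at t within A)"
  shows "((\<lambda>t. interp s c (v(l := p t))) has_real_derivative D * interp s (coeff_diff l c) (v(l := p t))) (at t within A)"
  using assms(1)
proof (induction s arbitrary: c)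
  case (Suc s)
  show ?case
  proof (cases "l = s")
    case True
    have upd: "interp s c (v(s := y)) = interp s c v" for c y by (intro interp_cong) auto
    have *: "interp s (coeff_diff s c) v = interp s (\<lambda>T. c (insert s T)) v - interp s c v"
      using interp_cong[of s "coeff_diff s c" "\<lambda>T. 1 * c (insert s T) + (-1) * c T" v v]
      unfolding interp_lincomb by (force simp: coeff_diff_def)
    have **: "(\<lambda>T. coeff_diff s c (insert s T)) = (\<lambda>T. coeff_diff s c T)" by (auto simp: coeff_diff_def)
    have f: "(\<lambda>t. interp (Suc s) c (v(s := p t))) = (\<lambda>t. (1 - p t) * interp s c v + p t * interp s (\<lambda>T. c (insert s T)) v)"
      by (simp only: interp.simps upd fun_upd_same)
    have g: "interp (Suc s) (coeff_diff s c) (v(s := p t)) = interp s (\<lambda>T. c (insert s T)) v - interp s c v"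
      by (simp only: interp.simps upd fun_upd_same ** *) (simp add: algebra_simps)
    show ?thesis unfolding True f g
      by (auto simp: algebra_simps intro!: derivative_eq_intros p)
  next
    case False
    with Suc have "l < s" by simp
    have *: "(\<lambda>T. coeff_diff l c (insert s T)) = coeff_diff l (\<lambda>T. c (insert s T))"
      using False by (auto simp: coeff_diff_def insert_commute insert_Diff_if)
    have vs: "(v(l := y)) s = v s" for y using False by simp
    have "((\<lambda>t. (1 - v s) * interp s c (v(l := p t)) + v s * interp s (\<lambda>T. c (insert s T)) (v(l := p t))) has_real_derivative
        (1 - v s) * (D * interp s (coeff_diff l c) (v(l := p t)))
        + v s * (D * interp s (coeff_diff l (\<lambda>T. c (insert s T))) (v(l := p t)))) (at t within A)"
      by (intro DERIV_add DERIV_cmult Suc.IH \<open>l < s\<close>)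
    moreover have "(1 - v s) * (D * interp s (coeff_diff l c) (v(l := p t)))
        + v s * (D * interp s (coeff_diff l (\<lambda>T. c (insert s T))) (v(l := p t)))
        = D * interp (Suc s) (coeff_diff l c) (v(l := p t))"
      unfolding interp.simps vs * by (simp add: algebra_simps del: fun_upd_apply)
    ultimately show ?thesis by (simp only: interp.simps vs)
  qed
qed simp

text \<open>On the branch of zero answers the functional applied after \<open>k\<close> answers is
  \<open>L (replicate k 0)\<close>, independently of the input.\<close>

lemma adaptive_info_zero:
  "(\<And>k. k < m \<Longrightarrow> L (replicate k 0) f = 0) \<Longrightarrow> adaptive_info L m f = replicate m 0"
  by (induction m) (auto simp: Let_def replicate_append_same)

text \<open>Coordinates with a label of at least \<open>s\<close> belong to no block and do not
  influence the test functions.\<close>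

locale weight_blocks = positive_weights +
  fixes s :: nat and blk :: "nat \<Rightarrow> nat"
  assumes block_sum: "\<And>l. l < s \<Longrightarrow> 2 \<le> (\<Sum>j | j \<in> {1..d} \<and> blk j = l. \<gamma> d j)"
begin

definition S :: "nat \<Rightarrow> real" where
  "S l = (\<Sum>j | j \<in> {1..d} \<and> blk j = l. \<gamma> d j)"

definition mean :: "point \<Rightarrow> nat \<Rightarrow> real" where
  "mean x l = (\<Sum>j | j \<in> {1..d} \<and> blk j = l. \<gamma> d j * x j) / S l"

text \<open>The value 0 off the cube is the normalization demanded by
  \<open>F_space\<close>.\<close>

definition bump :: "(nat set \<Rightarrow> real) \<Rightarrow> rfun" where
  "bump c x = (if x \<in> cube d then interp s c (mean x) else 0)"

lemma S_ge: "l < s \<Longrightarrow> 2 \<le> S l"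
  unfolding S_def by (rule block_sum)

lemma mean_in_unit: "x \<in> cube d \<Longrightarrow> l < s \<Longrightarrow> mean x l \<in> {0..1}"
proof -
  assume x: "x \<in> cube d" and l: "l < s"
  have "(\<Sum>j | j \<in> {1..d} \<and> blk j = l. \<gamma> d j * x j) \<le> S l"
    unfolding S_def using cube_coordinate[OF x] pos by (intro sum_mono) (force intro: mult_left_le)
  moreover have "0 \<le> (\<Sum>j | j \<in> {1..d} \<and> blk j = l. \<gamma> d j * x j)"
    using cube_coordinate[OF x] pos by (intro sum_nonneg mult_nonneg_nonneg) (force intro: less_imp_le)+
  ultimately show ?thesis using S_ge[OF l] by (simp add: mean_def)
qed

lemma mean_upd:
  assumes "j \<in> {1..d}"
  shows "mean (x(j := t)) = (mean x)(blk j := mean x (blk j) + \<gamma> d j / S (blk j) * (t - x j))"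
proof
  fix l
  show "mean (x(j := t)) l = ((mean x)(blk j := mean x (blk j) + \<gamma> d j / S (blk j) * (t - x j))) l"
  proof (cases "l = blk j")
    case True
    let ?J = "{i. i \<in> {1..d} \<and> blk i = blk j}"
    have J: "finite ?J" "j \<in> ?J" using assms by auto
    have "(\<Sum>i\<in>?J. \<gamma> d i * (x(j := t)) i) = \<gamma> d j * t + (\<Sum>i\<in>?J - {j}. \<gamma> d i * x i)"
      using J by (subst sum.remove[of _ j]) auto
    moreover have "(\<Sum>i\<in>?J. \<gamma> d i * x i) = \<gamma> d j * x j + (\<Sum>i\<in>?J - {j}. \<gamma> d i * x i)"
      using J by (subst sum.remove[of _ j]) auto
    ultimately have "(\<Sum>i\<in>?J. \<gamma> d i * (x(j := t)) i) = (\<Sum>i\<in>?J. \<gamma> d i * x i) + \<gamma> d j * (t - x j)"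
      by (simp add: algebra_simps)
    then show ?thesis unfolding True by (simp add: mean_def add_divide_distrib)
  next
    case False
    have "(\<Sum>i | i \<in> {1..d} \<and> blk i = l. \<gamma> d i * (x(j := t)) i) = (\<Sum>i | i \<in> {1..d} \<and> blk i = l. \<gamma> d i * x i)"
      using False by (intro sum.cong) auto
    then show ?thesis using False by (simp add: mean_def)
  qed
qed

lemma bump_bound:
  assumes "\<And>T. T \<subseteq> {..<s} \<Longrightarrow> \<bar>c T\<bar> \<le> B" and "x \<in> cube d"
  shows "\<bar>bump c x\<bar> \<le> B"
  using interp_bound[of s c B "mean x"] mean_in_unit assms by (simp add: bump_def)

lemma bump_lincomb: "(\<lambda>x. a * bump c x + b * bump c' x) = bump (\<lambda>T. a * c T + b * c' T)"
  by (auto simp: bump_def interp_lincomb)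

lemma continuous_on_bump: "continuous_on (cube d) (bump c)"
proof -
  have "continuous_on (cube d) (\<lambda>x. interp s c (mean x))"
    unfolding mean_def divide_inverse
    by (intro continuous_on_interp continuous_intros continuous_on_product_then_coordinatewise[OF continuous_on_id])
  then show ?thesis by (subst continuous_on_cong[OF refl, of _ _ "\<lambda>x. interp s c (mean x)"]) (auto simp: bump_def)
qed

lemma bump_partial_deriv:
  assumes x: "x \<in> cube d" and j: "j \<in> {1..d}"
  shows "((\<lambda>t. bump c (x(j := t))) has_real_derivative
      (if blk j < s then bump (\<lambda>T. \<gamma> d j / S (blk j) * coeff_diff (blk j) c T) x else 0)) (at (x j) within {0..1})"
proof -
  let ?p = "\<lambda>t. mean x (blk j) + \<gamma> d j / S (blk j) * (t - x j)"
  have eq: "bump c (x(j := t)) = interp s c ((mean x)(blk j := ?p t))" if "t \<in> {0..1}" for t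
    using cube_upd[OF x j that] by (simp only: bump_def if_True mean_upd[OF j])
  have "((\<lambda>t. interp s c ((mean x)(blk j := ?p t))) has_real_derivative
      (if blk j < s then bump (\<lambda>T. \<gamma> d j / S (blk j) * coeff_diff (blk j) c T) x else 0)) (at (x j) within {0..1})"
  proof (cases "blk j < s")
    case True
    have p: "(?p has_real_derivative \<gamma> d j / S (blk j)) (at (x j) within {0..1})"
      using S_ge[OF True] by (auto intro!: derivative_eq_intros)
    show ?thesis
      using interp_has_derivative[OF True p, of c "mean x"] interp_lincomb[of s "\<gamma> d j / S (blk j)" "coeff_diff (blk j) c" 0 "\<lambda>_. 0"] x True
      by (simp add: bump_def)
  next
    case False
    have "interp s c ((mean x)(blk j := y)) = interp s c (mean x)" for y
      using False by (intro interp_cong) auto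
    then show ?thesis using False by simp
  qed
  then show ?thesis
    by (rule has_field_derivative_transform_within[OF _ zero_less_one cube_coordinate[OF x j]]) (simp add: eq)
qed

text \<open>Partial differentiation maps \<open>bumps B\<close> to \<open>bumps (\<gamma> d j * B)\<close>: an affine function on \<open>[0,1]\<close> has a
  derivative of at most twice its maximum, which the block weight \<open>S l \<ge> 2\<close> compensates.\<close>

definition bumps :: "real \<Rightarrow> rfun set" where
  "bumps B = {bump c | c. \<forall>T. T \<subseteq> {..<s} \<longrightarrow> \<bar>c T\<bar> \<le> B}"

lemma bumps_partial_deriv:
  assumes "f \<in> bumps B" and j: "j \<in> {1..d}"
  shows "\<exists>g\<in>bumps (\<gamma> d j * B). \<forall>x\<in>cube d. ((\<lambda>t. f (x(j := t))) has_real_derivative g x) (at (x j) within {0..1})"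
proof -
  obtain c where f: "f = bump c" and c: "\<And>T. T \<subseteq> {..<s} \<Longrightarrow> \<bar>c T\<bar> \<le> B" using assms by (auto simp: bumps_def)
  define c' where "c' = (\<lambda>T. if blk j < s then \<gamma> d j / S (blk j) * coeff_diff (blk j) c T else 0)"
  have "\<bar>c' T\<bar> \<le> \<gamma> d j * B" if T: "T \<subseteq> {..<s}" for T
  proof (cases "blk j < s")
    case True
    have S: "2 \<le> S (blk j)" by (rule S_ge[OF True])
    have "\<bar>c (insert (blk j) T)\<bar> \<le> B" "\<bar>c (T - {blk j})\<bar> \<le> B" using T True by (auto intro!: c)
    then have "\<bar>coeff_diff (blk j) c T\<bar> \<le> 2 * B" unfolding coeff_diff_def by linarith
    moreover have "\<bar>\<gamma> d j / S (blk j)\<bar> \<le> \<gamma> d j / 2" using S pos[OF j] divide_left_mono[of 2 "S (blk j)" "\<gamma> d j"] by simp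
    ultimately have "\<bar>\<gamma> d j / S (blk j)\<bar> * \<bar>coeff_diff (blk j) c T\<bar> \<le> (\<gamma> d j / 2) * (2 * B)"
      using pos[OF j] by (intro mult_mono) auto
    then show ?thesis using True by (simp add: c'_def abs_mult)
  next
    case False
    have "0 \<le> B" using c[of "{}"] by force
    then show ?thesis using False pos[OF j] by (simp add: c'_def)
  qed
  then have "bump c' \<in> bumps (\<gamma> d j * B)" by (auto simp: bumps_def)
  moreover have "bump c' x = (if blk j < s then bump (\<lambda>T. \<gamma> d j / S (blk j) * coeff_diff (blk j) c T) x else 0)" if "x \<in> cube d" for x
    using interp_lincomb[of s 0 "\<lambda>_. 0" 0 "\<lambda>_. 0" "mean x"] by (auto simp: c'_def bump_def)
  ultimately show ?thesis using bump_partial_deriv[OF _ j] unfolding f by (intro bexI[of _ "bump c'"]) auto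
qed

lemma smooth_bump: "smooth_on_cube d (bump c)"
proof (rule smooth_on_cube_family[of "\<Union> (range bumps)"])
  show "bump c \<in> \<Union> (range bumps)"
  proof -
    \<comment> \<open>There are only finitely many vertices, so any vertex values have a common
      bound.\<close>
    have "\<bar>c T\<bar> \<le> Max ((\<lambda>T. \<bar>c T\<bar>) ` Pow {..<s})" if "T \<subseteq> {..<s}" for T
      using that by (intro Max_ge) auto
    then have "bump c \<in> bumps (Max ((\<lambda>T. \<bar>c T\<bar>) ` Pow {..<s}))" unfolding bumps_def by blast
    then show ?thesis by blast
  qed
  show "continuous_on (cube d) f" if "f \<in> \<Union> (range bumps)" for f
    using that continuous_on_bump by (auto simp: bumps_def)
  show "\<exists>g\<in>\<Union> (range bumps). \<forall>x\<in>cube d. ((\<lambda>t. f (x(j := t))) has_real_derivative g x) (at (x j) within {0..1})"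
    if "f \<in> \<Union> (range bumps)" "j \<in> {1..d}" for f j
    using that bumps_partial_deriv[of f _ j] by blast
qed

text \<open>Each differentiation scales the coefficient bound by the weight of its direction, so the
  mixed derivative is bounded by \<open>weight \<gamma> d \<alpha> * B\<close> and the weight
  cancels in the norm.\<close>

lemma F_norm_bump:
  assumes "\<And>T. T \<subseteq> {..<s} \<Longrightarrow> \<bar>c T\<bar> \<le> B"
  shows "F_norm \<gamma> d (bump c) \<le> ereal B"
proof (rule F_norm_le[OF smooth_bump weight_pos])
  fix \<alpha> x assume x: "x \<in> cube d"
  have "bump c \<in> bumps B" using assms by (auto simp: bumps_def)
  from foldr_partial_deriv_family[of bumps d "\<gamma> d", OF bumps_partial_deriv this set_multi_list_upt, of \<alpha>]
  obtain g where "g \<in> bumps (weight \<gamma> d \<alpha> * B)" "mixed_deriv d \<alpha> (bump c) x = g x"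
    using x unfolding prod_list_weight mixed_deriv_eq by blast
  then show "\<bar>mixed_deriv d \<alpha> (bump c) x\<bar> \<le> weight \<gamma> d \<alpha> * B"
    using bump_bound[OF _ x] by (auto simp: bumps_def)
qed

lemma bump_F_space: "bump c \<in> F_space \<gamma> d"
proof -
  have "\<bar>c T\<bar> \<le> Max ((\<lambda>T. \<bar>c T\<bar>) ` Pow {..<s})" if "T \<subseteq> {..<s}" for T
    using that by (intro Max_ge) auto
  from F_norm_bump[OF this] have "F_norm \<gamma> d (bump c) < \<infinity>"
    by (rule le_less_trans) auto
  then show ?thesis using smooth_bump by (auto simp: F_space_def bump_def)
qed

text \<open>If all coordinates of a block are 0, or all are 1, then so is the block mean. Hence the
  vertex values can be read off at points of the cube, and their maximum bounds the uniform norm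
  from below.\<close>

lemma bump_at_vertex:
  assumes T: "T \<subseteq> {..<s}"
  shows "\<exists>x\<in>cube d. \<forall>c. bump c x = c T"
proof -
  define x where "x j = (if j \<in> {1..d} then of_bool (blk j \<in> T) else undefined :: real)" for j
  have x: "x \<in> cube d" by (auto simp: cube_def x_def)
  have "mean x l = of_bool (l \<in> T)" if l: "l < s" for l
  proof -
    have "(\<Sum>j | j \<in> {1..d} \<and> blk j = l. \<gamma> d j * x j) = (\<Sum>j | j \<in> {1..d} \<and> blk j = l. \<gamma> d j * of_bool (l \<in> T))"
      by (intro sum.cong) (auto simp: x_def)
    also have "\<dots> = S l * of_bool (l \<in> T)" by (simp add: S_def sum_distrib_right)
    finally show ?thesis using S_ge[OF l] by (simp add: mean_def)
  qed
  from interp_vertex[OF this] have "bump c x = c T" for c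
    using x T by (simp add: bump_def Int_absorb2)
  with x show ?thesis by blast
qed

text \<open>Two inputs of the unit ball with a common output cannot both be within \<open>e\<close>
  of it unless they differ by at most \<open>2 * e\<close> everywhere, in particular at the vertex
  \<open>T\<close>.\<close>

lemma error_lower_bound:
  assumes c: "\<And>T. T \<subseteq> {..<s} \<Longrightarrow> \<bar>c T\<bar> \<le> 1" and c': "\<And>T. T \<subseteq> {..<s} \<Longrightarrow> \<bar>c' T\<bar> \<le> 1"
    and A: "A (bump c) = A (bump c')" and err: "worst_case_error \<gamma> d A \<le> ereal e" and T: "T \<subseteq> {..<s}"
  shows "\<bar>c T - c' T\<bar> \<le> 2 * e"
proof -
  have *: "Linf_norm d (\<lambda>x. bump c x - A (bump c) x) \<le> ereal e" if "\<And>T. T \<subseteq> {..<s} \<Longrightarrow> \<bar>c T\<bar> \<le> 1" for c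
  proof -
    have "bump c \<in> {f \<in> F_space \<gamma> d. F_norm \<gamma> d f \<le> 1}"
      using bump_F_space F_norm_bump[OF that] by (simp add: one_ereal_def)
    from SUP_upper[OF this, of "\<lambda>f. Linf_norm d (\<lambda>x. f x - A f x)"] show ?thesis
      using err unfolding worst_case_error_def by simp
  qed
  obtain x where x: "x \<in> cube d" "\<And>c. bump c x = c T" using bump_at_vertex[OF T] by blast
  show ?thesis
    using Linf_dist_triangle[OF continuous_on_bump continuous_on_bump x(1) *[of c] *[of c', folded A]] c c' x(2)
    by simp
qed

text \<open>After numbering the vertex sets by \<open>idx\<close>, vertex values become points of a
  cube of dimension \<open>2 ^ s\<close>, and \<open>large_fibre\<close> applies. Continuity holds
  because \<open>F_norm_bump\<close> bounds the norm of a difference by the maximal difference of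
  vertex values.\<close>

lemma indistinguishable_bumps:
  fixes n :: nat and L :: "nat \<Rightarrow> rfun \<Rightarrow> real"
  assumes n: "n < 2 ^ s" and L: "\<And>k. k < n \<Longrightarrow> continuous_functional \<gamma> d (L k)"
  shows "\<exists>c c' T. (\<forall>T\<subseteq>{..<s}. c T \<in> {0..1}) \<and> (\<forall>T\<subseteq>{..<s}. c' T \<in> {0..1}) \<and>
    (\<forall>k<n. L k (bump c) = L k (bump c')) \<and> T \<subseteq> {..<s} \<and> 1/2 \<le> \<bar>c T - c' T\<bar>"
proof -
  obtain idx where idx: "bij_betw idx (Pow {..<s}) {..<(2::nat) ^ s}"
    using ex_bij_betw_finite_nat[of "Pow {..<s}"] by (auto simp: card_Pow atLeast0LessThan)
  have idx_less: "idx T < 2 ^ s" if "T \<subseteq> {..<s}" for T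
    using bij_betw_apply[OF idx, of T] that by simp
  interpret cube_map "2 ^ s" n "\<lambda>x k. L k (bump (x \<circ> idx))"
  proof
    fix x :: "nat \<Rightarrow> real" and k and \<epsilon> :: real assume "k < n" "0 < \<epsilon>"
    then obtain \<delta> where \<delta>: "\<delta> > 0"
      and close: "\<And>g. g \<in> F_space \<gamma> d \<Longrightarrow> F_norm \<gamma> d (\<lambda>z. g z - bump (x \<circ> idx) z) < ereal \<delta> \<Longrightarrow> \<bar>L k g - L k (bump (x \<circ> idx))\<bar> < \<epsilon>"
      using L bump_F_space unfolding continuous_functional_def by meson
    have "\<bar>L k (bump (y \<circ> idx)) - L k (bump (x \<circ> idx))\<bar> < \<epsilon>" if y: "\<forall>i<2 ^ s. \<bar>y i - x i\<bar> < \<delta> / 2" for y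
    proof (rule close[OF bump_F_space])
      \<comment> \<open>\<open>F_norm_bump\<close> yields only a weak inequality, so half of
        \<open>\<delta>\<close> is used.\<close>
      have "F_norm \<gamma> d (bump (\<lambda>T. 1 * (y \<circ> idx) T + (-1) * (x \<circ> idx) T)) \<le> ereal (\<delta> / 2)"
        by (rule F_norm_bump) (use y idx_less in \<open>auto intro: less_imp_le\<close>)
      then have "F_norm \<gamma> d (\<lambda>z. bump (y \<circ> idx) z - bump (x \<circ> idx) z) \<le> ereal (\<delta> / 2)"
        unfolding bump_lincomb[symmetric] by (simp add: comp_def)
      also have "\<dots> < ereal \<delta>" using \<delta> by simp
      finally show "F_norm \<gamma> d (\<lambda>z. bump (y \<circ> idx) z - bump (x \<circ> idx) z) < ereal \<delta>" .
    qed
    then show "\<exists>\<delta>>0. \<forall>y. (\<forall>i<2 ^ s. y i \<in> {0..1}) \<longrightarrow> (\<forall>i<2 ^ s. \<bar>y i - x i\<bar> < \<delta>) \<longrightarrow>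
        \<bar>L k (bump (y \<circ> idx)) - L k (bump (x \<circ> idx))\<bar> < \<epsilon>"
      using \<delta> by (intro exI[of _ "\<delta> / 2"]) auto
  qed (rule n)
  obtain x z i where x: "x \<in> Q" and z: "z \<in> Q" and eq: "\<forall>k<n. L k (bump (x \<circ> idx)) = L k (bump (z \<circ> idx))"
    and i: "i < 2 ^ s" "1/2 \<le> \<bar>x i - z i\<bar>"
    using large_fibre by blast
  obtain T where T: "T \<subseteq> {..<s}" "idx T = i"
    using idx i(1) unfolding bij_betw_def by (metis PowD imageE lessThan_iff)
  show ?thesis
    by (rule exI[of _ "x \<circ> idx"], rule exI[of _ "z \<circ> idx"], rule exI[of _ T]) (use x z eq i T idx_less in \<open>auto simp: Q_def\<close>)
qed

text \<open>The constant 1/4 is half the separation 1/2 of indistinguishable inputs. Linear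
  algorithms are covered by the non-adaptive argument, since their output depends only on the values
  of the functionals.\<close>

lemma error_lower_bound_class:
  assumes alg: "A \<in> linear_algorithms \<gamma> d n \<union> general_algorithms \<gamma> d n" and n: "n < 2 ^ s"
    and err: "worst_case_error \<gamma> d A \<le> ereal e"
  shows "1/4 \<le> e"
proof -
  have nonadaptive: "1/4 \<le> e"
    if "m \<le> n" and L: "\<And>j. j \<in> {1..m} \<Longrightarrow> continuous_functional \<gamma> d (L j)"
      and A: "\<And>f g. f \<in> F_space \<gamma> d \<Longrightarrow> g \<in> F_space \<gamma> d \<Longrightarrow> (\<And>j. j \<in> {1..m} \<Longrightarrow> L j f = L j g) \<Longrightarrow> A f = A g"
    for m and L :: "nat \<Rightarrow> rfun \<Rightarrow> real"
  proof -
    have mn: "m < 2 ^ s" using that(1) n by simp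
    \<comment> \<open>Information is numbered from 1, the components of the fibre theorem from
      0.\<close>
    have Lc: "continuous_functional \<gamma> d (L (Suc k))" if "k < m" for k using that by (intro L) auto
    obtain c c' T where c: "\<And>T. T \<subseteq> {..<s} \<Longrightarrow> c T \<in> {0..1}" "\<And>T. T \<subseteq> {..<s} \<Longrightarrow> c' T \<in> {0..1}"
      and eq: "\<And>k. k < m \<Longrightarrow> L (Suc k) (bump c) = L (Suc k) (bump c')" and T: "T \<subseteq> {..<s}" "1/2 \<le> \<bar>c T - c' T\<bar>"
      using indistinguishable_bumps[of m "\<lambda>k. L (Suc k)", OF mn Lc] by metis
    have "L j (bump c) = L j (bump c')" if "j \<in> {1..m}" for j using eq[of "j - 1"] that by auto
    then have "A (bump c) = A (bump c')" by (intro A bump_F_space)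
    from error_lower_bound[OF _ _ this err T(1)] c have "\<bar>c T - c' T\<bar> \<le> 2 * e" by force
    with T show ?thesis by simp
  qed
  consider (lin) m L g where "m \<le> n" "\<forall>j\<in>{1..m}. continuous_linear_functional \<gamma> d (L j)"
      "\<forall>f\<in>F_space \<gamma> d. A f = (\<lambda>x. \<Sum>j=1..m. L j f * g j x)"
    | (nonad) m L \<phi> where "m \<le> n" "\<forall>j\<in>{1..m}. continuous_functional \<gamma> d (L j)"
      "\<forall>f\<in>F_space \<gamma> d. A f = \<phi> (nonadaptive_info L m f)"
    | (ad) m L \<phi> where "m \<le> n" "\<forall>y. length y < m \<longrightarrow> continuous_linear_functional \<gamma> d (L y)"
      "\<forall>f\<in>F_space \<gamma> d. A f = \<phi> (adaptive_info L m f)"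
    using alg unfolding linear_algorithms_def general_algorithms_def nonadaptive_continuous_information_def
      adaptive_linear_information_def by blast
  then show ?thesis
  proof cases
    case lin
    show ?thesis
    proof (rule nonadaptive[OF lin(1), of L])
      show "A f = A g" if "f \<in> F_space \<gamma> d" "g \<in> F_space \<gamma> d" "\<And>j. j \<in> {1..m} \<Longrightarrow> L j f = L j g" for f g
        using lin(3) that by simp
    qed (use lin(2) in \<open>auto simp: continuous_linear_functional_def\<close>)
  next
    case nonad
    show ?thesis
    proof (rule nonadaptive[OF nonad(1), of L])
      show "A f = A g" if "f \<in> F_space \<gamma> d" "g \<in> F_space \<gamma> d" "\<And>j. j \<in> {1..m} \<Longrightarrow> L j f = L j g" for f g
      proof -
        have "nonadaptive_info L m f = nonadaptive_info L m g" unfolding nonadaptive_info_def using that(3) by auto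
        then show ?thesis using nonad(3) that by simp
      qed
    qed (use nonad(2) in auto)
  next
    case ad
    \<comment> \<open>Only the \<open>m\<close> functionals on the branch of zero answers are
      considered; they form non-adaptive linear information.\<close>
    have lin: "continuous_linear_functional \<gamma> d (L (replicate k 0))" if "k < m" for k using ad(2) that by simp
    have mn: "m < 2 ^ s" using ad(1) n by simp
    have Lc: "continuous_functional \<gamma> d (L (replicate k 0))" if "k < m" for k
      using lin[OF that] by (simp add: continuous_linear_functional_def)
    obtain c c' T where c: "\<And>T. T \<subseteq> {..<s} \<Longrightarrow> c T \<in> {0..1}" "\<And>T. T \<subseteq> {..<s} \<Longrightarrow> c' T \<in> {0..1}"
      and eq: "\<And>k. k < m \<Longrightarrow> L (replicate k 0) (bump c) = L (replicate k 0) (bump c')"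
      and T: "T \<subseteq> {..<s}" "1/2 \<le> \<bar>c T - c' T\<bar>"
      using indistinguishable_bumps[of m "\<lambda>k. L (replicate k 0)", OF mn Lc] by metis
    have lincomb: "L (replicate k 0) (bump (\<lambda>T. a * c T + b * c' T)) = a * L (replicate k 0) (bump c) + b * L (replicate k 0) (bump c')"
      if "k < m" for k a b
    proof -
      have *: "(\<lambda>x. a * bump c x) = bump (\<lambda>T. a * c T)" for a c using bump_lincomb[of a c 0 c] by simp
      have F: "(\<lambda>x. a * bump c x) \<in> F_space \<gamma> d" for a c unfolding * by (rule bump_F_space)
      have "\<forall>f\<in>F_space \<gamma> d. \<forall>g\<in>F_space \<gamma> d. L (replicate k 0) (\<lambda>x. f x + g x) = L (replicate k 0) f + L (replicate k 0) g"
        using lin[OF that] unfolding continuous_linear_functional_def linear_functional_def by blast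
      from this[rule_format, OF F F]
      have "L (replicate k 0) (\<lambda>x. a * bump c x + b * bump c' x) = L (replicate k 0) (\<lambda>x. a * bump c x) + L (replicate k 0) (\<lambda>x. b * bump c' x)" .
      also have "\<dots> = a * L (replicate k 0) (bump c) + b * L (replicate k 0) (bump c')"
        using lin[OF that] bump_F_space unfolding continuous_linear_functional_def linear_functional_def by simp
      finally show ?thesis unfolding bump_lincomb .
    qed
    \<comment> \<open>By linearity the difference of the two indistinguishable inputs yields only
      zero answers, exactly like the zero function, so both get the same output. As \<open>c\<close>
      and \<open>c'\<close> take values in \<open>{0..1}\<close>, the difference still lies in the
      unit ball.\<close>
    have "adaptive_info L m (bump (\<lambda>T. 1 * c T + (-1) * c' T)) = replicate m 0"
    proof (rule adaptive_info_zero)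
      fix k assume k: "k < m"
      show "L (replicate k 0) (bump (\<lambda>T. 1 * c T + (-1) * c' T)) = 0"
        unfolding lincomb[OF k] eq[OF k] by simp
    qed
    moreover have "adaptive_info L m (bump (\<lambda>T. 0 * c T + 0 * c' T)) = replicate m 0"
    proof (rule adaptive_info_zero)
      fix k assume k: "k < m"
      show "L (replicate k 0) (bump (\<lambda>T. 0 * c T + 0 * c' T)) = 0"
        unfolding lincomb[OF k] by simp
    qed
    moreover have "A (bump e) = \<phi> (adaptive_info L m (bump e))" for e
      by (rule bspec[OF ad(3) bump_F_space])
    ultimately have same: "A (bump (\<lambda>T. 1 * c T + (-1) * c' T)) = A (bump (\<lambda>T. 0 * c T + 0 * c' T))"
      by (simp only:)
    have "\<bar>(1 * c T + (-1) * c' T) - (0 * c T + 0 * c' T)\<bar> \<le> 2 * e"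
    proof (rule error_lower_bound[where c = "\<lambda>T. 1 * c T + (-1) * c' T" and c' = "\<lambda>T. 0 * c T + 0 * c' T", OF _ _ same err T(1)])
      fix U assume "U \<subseteq> {..<s}"
      then have "c U \<in> {0..1}" "c' U \<in> {0..1}" by (rule c)+
      then show "\<bar>1 * c U + (-1) * c' U\<bar> \<le> 1" by (simp add: abs_le_iff)
    qed simp
    with T show ?thesis by simp
  qed
qed

lemma info_complexity_ge:
  assumes alg: "\<A> \<in> {linear_algorithms \<gamma>, general_algorithms \<gamma>}"
  shows "enat (2 ^ s) \<le> info_complexity \<gamma> \<A> (1/8) d"
  unfolding info_complexity_def
proof (rule Inf_greatest, clarify)
  fix n assume "minimal_error \<gamma> \<A> n d \<le> ereal (1/8)"
  \<comment> \<open>The infimum need not be attained; 3/16 lies strictly between the tolerance 1/8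
    and the barrier 1/4.\<close>
  then have "(INF A\<in>\<A> d n. worst_case_error \<gamma> d A) < ereal (3/16)"
    unfolding minimal_error_def by (rule le_less_trans) simp
  then obtain A where A: "A \<in> \<A> d n" "worst_case_error \<gamma> d A \<le> ereal (3/16)"
    by (auto simp: INF_less_iff intro: less_imp_le)
  then have "A \<in> linear_algorithms \<gamma> d n \<union> general_algorithms \<gamma> d n" using alg by auto
  from error_lower_bound_class[OF this _ A(2)] show "enat (2 ^ s) \<le> enat n" by force
qed

end

text \<open>The last block \<open>s\<close> is the unfinished one, of weight less than \<open>2\<close>.\<close>

lemma greedy_blocks:
  fixes w :: "nat \<Rightarrow> real"
  assumes "\<And>j. j \<in> {1..d} \<Longrightarrow> 0 < w j" and "\<And>j. j \<in> {1..d} \<Longrightarrow> w j \<le> C"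
  shows "\<exists>blk s. (\<forall>l<s. 2 \<le> (\<Sum>j | j \<in> {1..d} \<and> blk j = l. w j)) \<and> (\<forall>j\<in>{1..d}. blk j \<le> s) \<and>
    (\<Sum>j | j \<in> {1..d} \<and> blk j = s. w j) < 2 \<and>
    (\<Sum>j=1..d. w j) \<le> real s * (2 + C) + (\<Sum>j | j \<in> {1..d} \<and> blk j = (s::nat). w j)"
  using assms
proof (induction d)
  case 0
  then show ?case by (auto intro!: exI[of _ "0::nat"])
next
  case (Suc d)
  then obtain blk s where IH: "\<forall>l<s. 2 \<le> (\<Sum>j | j \<in> {1..d} \<and> blk j = l. w j)" "\<forall>j\<in>{1..d}. blk j \<le> s"
    "(\<Sum>j | j \<in> {1..d} \<and> blk j = s. w j) < 2"
    "(\<Sum>j=1..d. w j) \<le> real s * (2 + C) + (\<Sum>j | j \<in> {1..d} \<and> blk j = (s::nat). w j)"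
    by auto
  \<comment> \<open>The new coordinate joins the unfinished block \<open>s\<close>. Once this block
    reaches weight 2, it is closed and an empty block \<open>Suc s\<close> is opened.\<close>
  let ?b = "blk(Suc d := s)"
  let ?r = "\<Sum>j | j \<in> {1..d} \<and> blk j = s. w j"
  have other: "{j. j \<in> {1..Suc d} \<and> ?b j = l} = {j. j \<in> {1..d} \<and> blk j = l}" if "l \<noteq> s" for l
    using that by (auto simp: le_Suc_eq)
  have "{j. j \<in> {1..Suc d} \<and> ?b j = s} = insert (Suc d) {j. j \<in> {1..d} \<and> blk j = s}"
    by (auto simp: le_Suc_eq)
  then have cur: "(\<Sum>j | j \<in> {1..Suc d} \<and> ?b j = s. w j) = w (Suc d) + ?r" by simp
  have w: "0 < w (Suc d)" "w (Suc d) \<le> C" using Suc.prems by auto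
  show ?case
  proof (cases "w (Suc d) + ?r < 2")
    case True
    show ?thesis
    proof (intro exI[of _ ?b] exI[of _ s] conjI)
      show "\<forall>l<s. 2 \<le> (\<Sum>j | j \<in> {1..Suc d} \<and> ?b j = l. w j)"
      proof (intro allI impI)
        fix l assume "l < s"
        then show "2 \<le> (\<Sum>j | j \<in> {1..Suc d} \<and> ?b j = l. w j)"
          unfolding other[OF less_imp_neq[OF \<open>l < s\<close>]] using IH(1) by simp
      qed
      show "\<forall>j\<in>{1..Suc d}. ?b j \<le> s" using IH(2) by (auto simp: le_Suc_eq)
      show "(\<Sum>j | j \<in> {1..Suc d} \<and> ?b j = s. w j) < 2" unfolding cur by (rule True)
      show "(\<Sum>j=1..Suc d. w j) \<le> real s * (2 + C) + (\<Sum>j | j \<in> {1..Suc d} \<and> ?b j = s. w j)"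
        unfolding cur using IH(4) by simp
    qed
  next
    \<comment> \<open>The closed block weighs less than \<open>2 + C\<close>: it was below 2 before
      a weight of at most \<open>C\<close> was added.\<close>
    case False
    have "{j. j \<in> {1..Suc d} \<and> ?b j = Suc s} = {}" using IH(2) by force
    then have new: "(\<Sum>j | j \<in> {1..Suc d} \<and> ?b j = Suc s. w j) = 0" by (simp only: sum.empty)
    show ?thesis
    proof (intro exI[of _ ?b] exI[of _ "Suc s"] conjI)
      show "\<forall>l<Suc s. 2 \<le> (\<Sum>j | j \<in> {1..Suc d} \<and> ?b j = l. w j)"
      proof (intro allI impI)
        fix l assume "l < Suc s"
        show "2 \<le> (\<Sum>j | j \<in> {1..Suc d} \<and> ?b j = l. w j)"
        proof (cases "l = s")
          case True
          show ?thesis unfolding True cur using False by simp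
        next
          case neq: False
          then show ?thesis unfolding other[OF neq] using IH(1) \<open>l < Suc s\<close> by simp
        qed
      qed
      show "\<forall>j\<in>{1..Suc d}. ?b j \<le> Suc s" using IH(2) by (auto simp: le_Suc_eq)
      show "(\<Sum>j | j \<in> {1..Suc d} \<and> ?b j = Suc s. w j) < 2" unfolding new by simp
      show "(\<Sum>j=1..Suc d. w j) \<le> real (Suc s) * (2 + C) + (\<Sum>j | j \<in> {1..Suc d} \<and> ?b j = Suc s. w j)"
        unfolding new using IH(3,4) w by (simp add: algebra_simps)
    qed
  qed
qed

section \<open>Tractability\<close>

text \<open>A finite limit superior bounds all but finitely many terms, and those are absorbed into
  a maximum.\<close>

lemma limsup_less_infinity_iff:
  "limsup (\<lambda>d. ereal (u d)) < \<infinity> \<longleftrightarrow> (\<exists>M. \<forall>d\<ge>1. u d \<le> M)"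
proof
  assume "limsup (\<lambda>d. ereal (u d)) < \<infinity>"
  then obtain r :: nat where "limsup (\<lambda>d. ereal (u d)) < ereal (real r)"
    by (auto simp: less_PInf_Ex_of_nat)
  then have "\<forall>\<^sub>F d in sequentially. ereal (u d) < ereal (real r)" by (rule Limsup_lessD)
  then obtain N where N: "\<And>d. N \<le> d \<Longrightarrow> u d < real r" by (auto simp: eventually_sequentially)
  have "u d \<le> Max (insert (real r) (u ` {..N}))" for d
  proof (cases "N \<le> d")
    case True
    then show ?thesis using less_imp_le[OF N[OF True]] by (intro order_trans[OF _ Max_ge[of _ "real r"]]) auto
  next
    case False
    then show ?thesis by (intro Max_ge) auto
  qed
  then show "\<exists>M. \<forall>d\<ge>1. u d \<le> M" by blast
next
  assume "\<exists>M. \<forall>d\<ge>1. u d \<le> M"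
  then obtain M where "\<forall>d\<ge>1. u d \<le> M" by blast
  then have "limsup (\<lambda>d. ereal (u d)) \<le> ereal M"
    by (intro Limsup_bounded) (auto simp: eventually_sequentially)
  then show "limsup (\<lambda>d. ereal (u d)) < \<infinity>" by (rule le_less_trans) simp
qed

locale bounded_weights =
  fixes \<gamma> :: "nat \<Rightarrow> nat \<Rightarrow> real" and C :: real and \<A> :: algorithm_class
  assumes positive: "\<And>d j. j \<in> {1..d} \<Longrightarrow> 0 < \<gamma> d j"
    and bounded: "\<And>d j. j \<in> {1..d} \<Longrightarrow> \<gamma> d j \<le> C"
    and algorithms: "\<A> \<in> {linear_algorithms \<gamma>, general_algorithms \<gamma>}"
begin

lemma C_pos: "0 < C"
  using positive[of 1 1] bounded[of 1 1] by simp

text \<open>At tolerance 1/8, tractability bounds \<open>2 ^ s\<close> by a constant times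
  \<open>real d powr q\<close>, so \<open>s\<close> grows at most like
  \<open>1 + q * ln (real d)\<close>; the total weight is at most \<open>(2 + C) * s + 2\<close>.
  For \<open>q = 0\<close> the bound is uniform in \<open>d\<close>, which serves strong
  tractability.\<close>

lemma tractable_imp_weight_sum_bound:
  assumes K: "0 < K" and q: "0 \<le> q" and tr: "tractable_with_exponents \<gamma> \<A> K p q"
  shows "\<exists>M\<ge>0. \<forall>d\<ge>1. (\<Sum>j=1..d. \<gamma> d j) \<le> M * (1 + q * ln (real d))"
proof (intro exI conjI allI impI)
  \<comment> \<open>The logarithm may be negative. Adding 1 to its modulus lets
    \<open>?L + X\<close> be bounded by the product \<open>(?L + 1) * (1 + X)\<close> for
    \<open>X \<ge> 0\<close>.\<close>
  let ?L = "\<bar>ln (K * 8 powr p)\<bar>"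
  let ?M = "(2 + C) * ((?L + 1) / ln 2) + 2"
  show "0 \<le> ?M" using C_pos by simp
  fix d :: nat assume d: "1 \<le> d"
  obtain blk s where blk: "\<And>l. l < s \<Longrightarrow> 2 \<le> (\<Sum>j | j \<in> {1..d} \<and> blk j = l. \<gamma> d j)"
    and rest: "(\<Sum>j | j \<in> {1..d} \<and> blk j = s. \<gamma> d j) < 2"
    and total: "(\<Sum>j=1..d. \<gamma> d j) \<le> real s * (2 + C) + (\<Sum>j | j \<in> {1..d} \<and> blk j = s. \<gamma> d j)"
    using greedy_blocks[of d "\<gamma> d" C] positive bounded by blast
  interpret weight_blocks \<gamma> d s blk
    by unfold_locales (use positive blk in auto)
  have "ereal (2 ^ s) = ereal_of_enat (enat (2 ^ s))" by simp
  also have "\<dots> \<le> ereal_of_enat (info_complexity \<gamma> \<A> (1/8) d)"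
    using info_complexity_ge[OF algorithms] by (simp only: ereal_of_enat_le_iff)
  also have "\<dots> \<le> ereal (K * (1/8) powr (- p) * real d powr q)"
    using tr d unfolding tractable_with_exponents_def by simp
  also have "(1/8) powr (- p) = 8 powr p" by (simp add: powr_minus_divide powr_divide)
  finally have "2 ^ s \<le> (K * 8 powr p) * real d powr q" by simp
  then have "ln (2 ^ s) \<le> ln ((K * 8 powr p) * real d powr q)"
    using K d by (subst ln_le_cancel_iff) auto
  then have "real s * ln 2 \<le> ln (K * 8 powr p) + q * ln (real d)"
    using K d by (simp add: ln_mult ln_powr ln_realpow)
  also have "\<dots> \<le> (?L + 1) * (1 + q * ln (real d))"
  proof -
    have X: "0 \<le> q * ln (real d)" using q d by simp
    have "(?L + 1) * (1 + q * ln (real d)) = ?L + 1 + ?L * (q * ln (real d)) + q * ln (real d)"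
      by (simp add: algebra_simps)
    moreover have "0 \<le> ?L * (q * ln (real d))" using X by (rule mult_nonneg_nonneg[OF abs_ge_zero])
    ultimately show ?thesis by linarith
  qed
  finally have s: "real s \<le> (?L + 1) / ln 2 * (1 + q * ln (real d))" by (simp add: field_simps)
  have "(\<Sum>j=1..d. \<gamma> d j) \<le> real s * (2 + C) + 2" using total rest by simp
  also have "\<dots> \<le> ((?L + 1) / ln 2 * (1 + q * ln (real d))) * (2 + C) + 2 * (1 + q * ln (real d))"
    using C_pos q d by (intro add_mono mult_right_mono s) auto
  also have "\<dots> = ?M * (1 + q * ln (real d))" by (simp add: algebra_simps)
  finally show "(\<Sum>j=1..d. \<gamma> d j) \<le> ?M * (1 + q * ln (real d))" .
qed

text \<open>Reduces both kinds of tractability to the growth in \<open>d\<close> of one exponential;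
  the exponent of \<open>1 / \<epsilon>\<close> is \<open>\<kappa> / (1 - \<kappa>)\<close> in
  either case.\<close>

lemma tractable_of_weight_sum_bound:
  assumes \<kappa>: "0 < \<kappa>" "\<kappa> < 1"
  shows "\<exists>K\<ge>0. \<forall>B q. (\<forall>d\<ge>1. exp (K * (\<Sum>j=1..d. \<gamma> d j powr \<kappa>)) \<le> B * real d powr q) \<longrightarrow>
    tractable_with_exponents \<gamma> \<A> B (\<kappa> / (1 - \<kappa>)) q"
proof -
  obtain K where "0 \<le> K" and K: "\<And>g. 0 < g \<Longrightarrow> g \<le> C \<Longrightarrow>
      (\<exists>s. ((\<lambda>k. (g ^ k / fact k) powr \<kappa>) has_sum s) UNIV \<and> s \<le> exp (K * g powr \<kappa>))"
    using factorial_powr_sum_bound[OF C_pos \<kappa>(1)] by blast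
  have "tractable_with_exponents \<gamma> \<A> B (\<kappa> / (1 - \<kappa>)) q"
    if B: "\<forall>d\<ge>1. exp (K / (1 - \<kappa>) * (\<Sum>j=1..d. \<gamma> d j powr \<kappa>)) \<le> B * real d powr q" for B q
    unfolding tractable_with_exponents_def
  proof (intro allI impI)
    fix \<epsilon> :: real and d :: nat assume \<epsilon>: "0 < \<epsilon>" and d: "1 \<le> d"
    interpret positive_weights \<gamma> d by unfold_locales (rule positive)
    obtain n where n: "info_complexity \<gamma> \<A> \<epsilon> d \<le> enat n"
      and le: "real n \<le> exp (K / (1 - \<kappa>) * (\<Sum>j=1..d. \<gamma> d j powr \<kappa>)) * \<epsilon> powr (- (\<kappa> / (1 - \<kappa>)))"
      using info_complexity_le[OF algorithms bounded \<kappa> K \<epsilon>] by blast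
    have "ereal_of_enat (info_complexity \<gamma> \<A> \<epsilon> d) \<le> ereal_of_enat (enat n)"
      using n by (simp only: ereal_of_enat_le_iff)
    also have "\<dots> = ereal (real n)" by simp
    also have "real n \<le> (B * real d powr q) * \<epsilon> powr (- (\<kappa> / (1 - \<kappa>)))"
      using B d by (intro order_trans[OF le] mult_right_mono) auto
    finally show "ereal_of_enat (info_complexity \<gamma> \<A> \<epsilon> d) \<le> ereal (B * \<epsilon> powr (- (\<kappa> / (1 - \<kappa>))) * real d powr q)"
      by (simp add: mult_ac)
  qed
  \<comment> \<open>The constant passed on absorbs the factor \<open>1 / (1 - \<kappa>)\<close> from
    \<open>info_complexity_le\<close>.\<close>
  then show ?thesis using \<open>0 \<le> K\<close> \<kappa> by (intro exI[of _ "K / (1 - \<kappa>)"]) auto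
qed

section \<open>The four implications between tractability and the exponents\<close>

lemma polynomially_tractable_imp_q_exponent_le:
  assumes "polynomially_tractable \<gamma> \<A>"
  shows "q_exponent \<gamma> \<le> 1"
proof -
  obtain K p q where "0 < K" "0 \<le> q" "tractable_with_exponents \<gamma> \<A> K p q"
    using assms unfolding polynomially_tractable_def by blast
  from tractable_imp_weight_sum_bound[OF this] obtain M where M: "0 \<le> M"
    and sum: "\<And>d. 1 \<le> d \<Longrightarrow> (\<Sum>j=1..d. \<gamma> d j) \<le> M * (1 + q * ln (real d))" by blast
  have "(\<Sum>j=1..d. \<gamma> d j powr 1) / ln (real d + 1) \<le> M * (1 / ln 2 + q)" if d: "1 \<le> d" for d
  proof -
    have "(\<Sum>j=1..d. \<gamma> d j powr 1) = (\<Sum>j=1..d. \<gamma> d j)"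
      using positive by (intro sum.cong) (auto simp: less_imp_le)
    also have "\<dots> \<le> M * (1 + q * ln (real d))" by (rule sum[OF d])
    \<comment> \<open>\<open>ln (real d + 1)\<close> is at least \<open>ln 2\<close>, so the
      constant term is absorbed into the logarithm.\<close>
    also have "\<dots> \<le> M * (ln (real d + 1) / ln 2 + q * ln (real d + 1))"
    proof (intro mult_left_mono add_mono M)
      have "ln 2 \<le> ln (real d + 1)" using d by (subst ln_le_cancel_iff) auto
      then show "1 \<le> ln (real d + 1) / ln 2" by simp
      show "ln (real d) \<le> ln (real d + 1)" using d by simp
    qed (use \<open>0 \<le> q\<close> in auto)
    also have "\<dots> = M * (1 / ln 2 + q) * ln (real d + 1)" by (simp add: algebra_simps)
    finally show ?thesis using d by (simp add: divide_le_eq)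
  qed
  then have "limsup (\<lambda>d. ereal ((\<Sum>j=1..d. \<gamma> d j powr 1) / ln (real d + 1))) < \<infinity>"
    unfolding limsup_less_infinity_iff by blast
  then show ?thesis unfolding q_exponent_def one_ereal_def
    by (intro Inf_lower CollectI exI[of _ "1::real"]) simp
qed

lemma strongly_tractable_imp_p_exponent_le:
  assumes "strongly_polynomially_tractable \<gamma> \<A>"
  shows "p_exponent \<gamma> \<le> 1"
proof -
  obtain K p where "0 < K" "tractable_with_exponents \<gamma> \<A> K p 0"
    using assms unfolding strongly_polynomially_tractable_def by blast
  from tractable_imp_weight_sum_bound[OF this(1) order_refl this(2)] obtain M where
    sum: "\<And>d. 1 \<le> d \<Longrightarrow> (\<Sum>j=1..d. \<gamma> d j) \<le> M" by auto
  have "(\<Sum>j=1..d. \<gamma> d j powr 1) = (\<Sum>j=1..d. \<gamma> d j)" for d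
    using positive by (intro sum.cong) (auto simp: less_imp_le)
  with sum have "limsup (\<lambda>d. ereal (\<Sum>j=1..d. \<gamma> d j powr 1)) < \<infinity>"
    unfolding limsup_less_infinity_iff by auto
  then show ?thesis unfolding p_exponent_def one_ereal_def
    by (intro Inf_lower CollectI exI[of _ "1::real"]) simp
qed

lemma q_exponent_less_imp_tractable:
  assumes "q_exponent \<gamma> < 1"
  shows "polynomially_tractable \<gamma> \<A>"
proof -
  obtain \<kappa> where \<kappa>: "0 < \<kappa>" "\<kappa> < 1"
    and "limsup (\<lambda>d. ereal ((\<Sum>j=1..d. \<gamma> d j powr \<kappa>) / ln (real d + 1))) < \<infinity>"
    using assms unfolding q_exponent_def Inf_less_iff one_ereal_def by auto
  then obtain M where M: "\<And>d. 1 \<le> d \<Longrightarrow> (\<Sum>j=1..d. \<gamma> d j powr \<kappa>) / ln (real d + 1) \<le> M"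
    unfolding limsup_less_infinity_iff by blast
  obtain K where K: "0 \<le> K" and tr: "\<And>B q. (\<forall>d\<ge>1. exp (K * (\<Sum>j=1..d. \<gamma> d j powr \<kappa>)) \<le> B * real d powr q) \<Longrightarrow>
    tractable_with_exponents \<gamma> \<A> B (\<kappa> / (1 - \<kappa>)) q"
    using tractable_of_weight_sum_bound[OF \<kappa>] by blast
  \<comment> \<open>From \<open>real d + 1 \<le> 2 * real d\<close> the exponential is at most
    \<open>2 * real d\<close> to the power \<open>?q\<close>; the maximum with 0 makes
    \<open>?q\<close> nonnegative.\<close>
  let ?q = "K * max 0 M"
  have "exp (K * (\<Sum>j=1..d. \<gamma> d j powr \<kappa>)) \<le> 2 powr ?q * real d powr ?q" if d: "1 \<le> d" for d
  proof -
    have "(\<Sum>j=1..d. \<gamma> d j powr \<kappa>) \<le> M * ln (real d + 1)"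
      using M[OF d] d by (simp add: divide_le_eq)
    also have "\<dots> \<le> max 0 M * ln (2 * real d)"
      using d by (intro mult_mono) auto
    finally have "K * (\<Sum>j=1..d. \<gamma> d j powr \<kappa>) \<le> K * (max 0 M * ln (2 * real d))"
      using K by (rule mult_left_mono)
    then have "exp (K * (\<Sum>j=1..d. \<gamma> d j powr \<kappa>)) \<le> exp (?q * ln (2 * real d))" by (simp add: mult.assoc)
    also have "\<dots> = (2 * real d) powr ?q" using d by (simp add: powr_def)
    also have "\<dots> = 2 powr ?q * real d powr ?q" by (rule powr_mult)
    finally show ?thesis .
  qed
  then have "tractable_with_exponents \<gamma> \<A> (2 powr ?q) (\<kappa> / (1 - \<kappa>)) ?q" by (intro tr) blast
  moreover have "0 < \<kappa> / (1 - \<kappa>)" "0 \<le> ?q" using \<kappa> K by auto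
  ultimately show ?thesis
    unfolding polynomially_tractable_def by (metis powr_gt_zero zero_neq_numeral)
qed

lemma p_exponent_less_imp_strongly_tractable:
  assumes "p_exponent \<gamma> < 1"
  shows "strongly_polynomially_tractable \<gamma> \<A>"
proof -
  obtain \<kappa> where \<kappa>: "0 < \<kappa>" "\<kappa> < 1"
    and "limsup (\<lambda>d. ereal (\<Sum>j=1..d. \<gamma> d j powr \<kappa>)) < \<infinity>"
    using assms unfolding p_exponent_def Inf_less_iff one_ereal_def by auto
  then obtain M where M: "\<And>d. 1 \<le> d \<Longrightarrow> (\<Sum>j=1..d. \<gamma> d j powr \<kappa>) \<le> M"
    unfolding limsup_less_infinity_iff by blast
  obtain K where K: "0 \<le> K" and tr: "\<And>B q. (\<forall>d\<ge>1. exp (K * (\<Sum>j=1..d. \<gamma> d j powr \<kappa>)) \<le> B * real d powr q) \<Longrightarrow>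
    tractable_with_exponents \<gamma> \<A> B (\<kappa> / (1 - \<kappa>)) q"
    using tractable_of_weight_sum_bound[OF \<kappa>] by blast
  have "tractable_with_exponents \<gamma> \<A> (exp (K * M)) (\<kappa> / (1 - \<kappa>)) 0"
    by (rule tr) (use K M in \<open>auto intro: mult_left_mono\<close>)
  moreover have "0 < \<kappa> / (1 - \<kappa>)" using \<kappa> by simp
  ultimately show ?thesis
    unfolding strongly_polynomially_tractable_def using exp_gt_zero by blast
qed

end

theorem theorem3:
  fixes \<gamma> :: "nat \<Rightarrow> nat \<Rightarrow> real" and C\<^sub>\<gamma> :: real and \<A> :: algorithm_class
  assumes bounded: "\<And>d. 1 \<le> d \<Longrightarrow> \<gamma> d 1 \<le> C\<^sub>\<gamma>"
    and decreasing: "\<And>d i j. 1 \<le> i \<Longrightarrow> i \<le> j \<Longrightarrow> j \<le> d \<Longrightarrow> \<gamma> d j \<le> \<gamma> d i"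
    and positive: "\<And>d j. 1 \<le> j \<Longrightarrow> j \<le> d \<Longrightarrow> 0 < \<gamma> d j"
    and algorithms: "\<A> \<in> {linear_algorithms \<gamma>, general_algorithms \<gamma>}"
  shows "(polynomially_tractable \<gamma> \<A> \<longrightarrow> q_exponent \<gamma> \<le> 1) \<and>
         (strongly_polynomially_tractable \<gamma> \<A> \<longrightarrow> p_exponent \<gamma> \<le> 1) \<and>
         (q_exponent \<gamma> < 1 \<longrightarrow> polynomially_tractable \<gamma> \<A>) \<and>
         (p_exponent \<gamma> < 1 \<longrightarrow> strongly_polynomially_tractable \<gamma> \<A>)"
proof -
  \<comment> \<open>Monotonicity carries the bound on the first weight over to all weights of the
    dimension.\<close>
  have "\<gamma> d j \<le> C\<^sub>\<gamma>" if "j \<in> {1..d}" for d j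
    using decreasing[of 1 j d] bounded[of d] that by auto
  then interpret bounded_weights \<gamma> C\<^sub>\<gamma> \<A>
    by unfold_locales (use positive algorithms in auto)
  show ?thesis
    using polynomially_tractable_imp_q_exponent_le strongly_tractable_imp_p_exponent_le
      q_exponent_less_imp_tractable p_exponent_less_imp_strongly_tractable by blast
qed

end
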